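(* Fix an integer $k\ge 1$. Let $X_n$ be the total number of variables (leaves) in a closed lambda-term of size $n$ chosen uniformly at random among all closed lambda-terms of size $n$ in which every De Bruijn index is at most $k$. Then $X_n$ is asymptotically normally distributed, and \[ \mathbb{E}X_n \sim \frac{k}{\sqrt{k}+2k}\,n, \qquad \mathbb{V}X_n \sim \frac{k^2}{2\sqrt{k}(\sqrt{k}+2k)^2}\,n, \qquad n\to\infty. \]
   Context: Lambda-terms are considered modulo $\alpha$-equivalence and represented as lambda-DAGs: the skeleton is a rooted plane unary-binary tree in which leaves are variables, unary nodes are abstractions ($\lambda$) and binary nodes are applications; the size of a term is the total number of nodes of this tree. The De Bruijn index of a variable occurrence is the number of abstractions (unary nodes) on the path from the leaf up to and including its binding $\lambda$. Equivalently, closed lambda-terms with all De Bruijn indices at most $k$ correspond bijectively to rooted plane unary-binary trees in which every leaf having $L$ unary ancestors (necessarily $L\ge 1$) carries a label from $\{1,\dots,\min(L,k)\}$; the size is the number of nodes. *)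

theory Defs
  imports "HOL-Probability.Probability"
begin

text \<open>
  Lambda-terms modulo alpha-equivalence, in De Bruijn notation. Indices start at 1: the index of
  an occurrence counts the abstractions on the path from the leaf up to and including its binder,
  so \<open>LVar 1\<close> is bound by the nearest enclosing \<open>LAbs\<close>.
\<close>

datatype lterm = LVar nat | LAbs lterm | LApp lterm lterm

text \<open>Every node, including leaves, counts 1 (unlike the generated function \<^term>\<open>size\<close>).\<close>

primrec node_count :: "lterm \<Rightarrow> nat" where
  "node_count (LVar i) = 1"
| "node_count (LAbs t) = 1 + node_count t"
| "node_count (LApp s t) = 1 + node_count s + node_count t"

primrec leaf_count :: "lterm \<Rightarrow> nat" where
  "leaf_count (LVar i) = 1"
| "leaf_count (LAbs t) = leaf_count t"
| "leaf_count (LApp s t) = leaf_count s + leaf_count t"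

primrec de_bruijn_indices :: "lterm \<Rightarrow> nat set" where
  "de_bruijn_indices (LVar i) = {i}"
| "de_bruijn_indices (LAbs t) = de_bruijn_indices t"
| "de_bruijn_indices (LApp s t) = de_bruijn_indices s \<union> de_bruijn_indices t"

text \<open>
  \<open>closed_under L t\<close>: every leaf of \<open>t\<close> is bound by an abstraction of \<open>t\<close> or by one of \<open>L\<close>
  abstractions placed above \<open>t\<close>.
\<close>

primrec closed_under :: "nat \<Rightarrow> lterm \<Rightarrow> bool" where
  "closed_under L (LVar i) \<longleftrightarrow> 1 \<le> i \<and> i \<le> L"
| "closed_under L (LAbs t) \<longleftrightarrow> closed_under (Suc L) t"
| "closed_under L (LApp s t) \<longleftrightarrow> closed_under L s \<and> closed_under L t"

definition closed_term :: "lterm \<Rightarrow> bool" where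
  "closed_term t \<longleftrightarrow> closed_under 0 t"

definition bounded_closed_terms :: "nat \<Rightarrow> nat \<Rightarrow> lterm set" where
  "bounded_closed_terms k n =
     {t. closed_term t \<and> (\<forall>i\<in>de_bruijn_indices t. i \<le> k) \<and> node_count t = n}"

text \<open>
  The two lemmas below show that the uniform distribution is well defined for \<open>n \<ge> 2\<close>;
  there are no closed terms of size 0 or 1.
\<close>

lemma finite_bounded_closed_terms: "finite (bounded_closed_terms k n)"
proof -
  have "finite {t. (\<forall>i\<in>de_bruijn_indices t. i \<le> k) \<and> node_count t \<le> n}" (is "finite (?B n)")
  proof (induction n)
    case 0
    have "t \<notin> ?B 0" for t by (cases t) auto
    then have "?B 0 = {}" by blast
    then show ?case by (simp only: finite.emptyI)
  next
    case (Suc n)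
    have "?B (Suc n) \<subseteq> LVar ` {..k} \<union> LAbs ` ?B n \<union> (\<lambda>(s, t). LApp s t) ` (?B n \<times> ?B n)"
    proof
      fix t assume "t \<in> ?B (Suc n)"
      then show "t \<in> LVar ` {..k} \<union> LAbs ` ?B n \<union> (\<lambda>(s, t). LApp s t) ` (?B n \<times> ?B n)"
        by (cases t) (auto simp: image_iff)
    qed
    then show ?case using Suc by (auto intro: finite_subset)
  qed
  then show ?thesis
    by (rule rev_finite_subset) (auto simp: bounded_closed_terms_def)
qed

lemma bounded_closed_terms_nonempty:
  assumes "k \<ge> 1" "n \<ge> 2"
  shows "bounded_closed_terms k n \<noteq> {}"
proof -
  define t where "t m = (LAbs ^^ m) (LVar 1)" for m
  have "node_count (t m) = m + 1 \<and> de_bruijn_indices (t m) = {1}" for m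
    by (induction m) (auto simp: t_def)
  moreover have "closed_under L (t m) \<longleftrightarrow> L + m \<ge> 1" for L m
    by (induction m arbitrary: L) (auto simp: t_def)
  ultimately have "t (n - 1) \<in> bounded_closed_terms k n"
    using assms by (auto simp: bounded_closed_terms_def closed_term_def)
  then show ?thesis by blast
qed

definition random_term :: "nat \<Rightarrow> nat \<Rightarrow> lterm pmf" where
  "random_term k n = pmf_of_set (bounded_closed_terms k n)"

definition mean_leaves :: "nat \<Rightarrow> nat \<Rightarrow> real" where
  "mean_leaves k n = measure_pmf.expectation (random_term k n) (\<lambda>t. real (leaf_count t))"

definition var_leaves :: "nat \<Rightarrow> nat \<Rightarrow> real" where
  "var_leaves k n = measure_pmf.variance (random_term k n) (\<lambda>t. real (leaf_count t))"

definition normalized_leaves :: "nat \<Rightarrow> nat \<Rightarrow> lterm \<Rightarrow> real" where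
  "normalized_leaves k n t = (real (leaf_count t) - mean_leaves k n) / sqrt (var_leaves k n)"

end

theory Submission
  imports Defs "HOL-Complex_Analysis.Complex_Analysis"
begin

text \<open>
  Let \<open>B\<^sub>L(z, u)\<close> count the terms below \<open>L\<close> abstractions by nodes (\<open>z\<close>) and leaves (\<open>u\<close>).
  Then \<open>B\<^sub>L = z (min L k u + B\<^bsub>L+1\<^esub> + B\<^sub>L\<^sup>2)\<close>, and \<open>B\<^bsub>k+1\<^esub> = B\<^sub>k\<close>.
  Hence \<open>B\<^sub>k\<close> has a square-root singularity at \<open>z = 1 / (1 + 2 \<surd>(k u))\<close>, whereas the
  square roots that lead from \<open>B\<^bsub>L+1\<^esub>\<close> to \<open>B\<^sub>L\<close> for \<open>L < k\<close> have a radicand \<open>1 - x\<close>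
  with the coefficients of \<open>x\<close> summing to less than 1 at that point, so they add no
  singularity. Transfer theorems are replaced by convolution estimates: after rescaling the
  singularity to 1, families of power series whose coefficients are asymptotic to a multiple of
  \<open>n\<^bsup>-3/2\<^esup>\<close>, uniformly in the parameter, are closed under products and under substitution
  into \<open>\<surd>(1 - x)\<close>. So with \<open>u = e\<^sup>s\<close> the moment generating function of the number of
  leaves is \<open>((1 + 2 \<surd>k e\<^bsup>s/2\<^esup>) / (1 + 2 \<surd>k))\<^sup>n E\<^sub>n(s)\<close> with \<open>E\<^sub>n\<close> uniformly
  convergent near \<open>s = 0\<close>, and the quasi-powers argument yields both moments and the normal
  limit.
\<close>

unbundle no vec_syntax
unbundle fps_syntax

section \<open>Coefficients of order $n^{-3/2}$\<close>

lemma uniform_limit_transform: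
  assumes "uniform_limit U f l F" "\<forall>\<^sub>F n in F. \<forall>s\<in>U. f n s = g n s" "\<And>s. s \<in> U \<Longrightarrow> l s = m s"
  shows "uniform_limit U g m F"
  using uniform_limit_cong[of U f g F l m] assms by blast

lemma uniform_limit_sum:
  fixes f :: "'i \<Rightarrow> 'n \<Rightarrow> 'p \<Rightarrow> 'b :: real_normed_vector"
  assumes "\<And>i. i \<in> I \<Longrightarrow> uniform_limit U (f i) (l i) F"
  shows "uniform_limit U (\<lambda>n s. \<Sum>i\<in>I. f i n s) (\<lambda>s. \<Sum>i\<in>I. l i s) F"
  using assms
  by (induction I rule: infinite_finite_induct) (auto intro!: uniform_limit_intros)

text \<open>Dominated convergence for series: \<open>M\<close> depends on neither \<open>n\<close>
  nor \<open>s\<close>, so one cutoff \<open>N\<close> makes the tails of both series small for all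
  of them at once, and only finitely many uniform limits remain.\<close>

lemma uniform_tannery:
  fixes a :: "nat \<Rightarrow> nat \<Rightarrow> 'p \<Rightarrow> complex"
  assumes lim: "\<And>k. uniform_limit U (\<lambda>n s. a k n s) (b k) sequentially"
    and bound: "\<And>k n s. s \<in> U \<Longrightarrow> norm (a k n s) \<le> M k"
    and M: "summable M"
  shows "uniform_limit U (\<lambda>n s. \<Sum>k. a k n s) (\<lambda>s. \<Sum>k. b k s) sequentially"
proof (rule uniform_limitI)
  fix e :: real assume e: "e > 0"
  have bb: "norm (b k s) \<le> M k" if s: "s \<in> U" for k s
  proof (rule tendsto_upperbound)
    show "((\<lambda>n. norm (a k n s)) \<longlongrightarrow> norm (b k s)) sequentially"
      by (intro tendsto_norm tendsto_uniform_limitI[OF lim s])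
  qed (use bound[OF s] in auto)
  have M0: "M k \<ge> 0" if "s \<in> U" for k s
    using bound[OF that, of k 0] norm_ge_zero order_trans by blast
  obtain N where N: "norm (\<Sum>k. M (k + N)) < e / 4"
    using suminf_exist_split[OF _ M, of "e/4"] e by auto
  have "uniform_limit U (\<lambda>n s. \<Sum>k<N. a k n s) (\<lambda>s. \<Sum>k<N. b k s) sequentially"
    by (intro uniform_limit_sum lim)
  then have "\<forall>\<^sub>F n in sequentially. \<forall>s\<in>U. dist (\<Sum>k<N. a k n s) (\<Sum>k<N. b k s) < e / 4"
    using e by (intro uniform_limitD) auto
  then show "\<forall>\<^sub>F n in sequentially. \<forall>s\<in>U. dist (\<Sum>k. a k n s) (\<Sum>k. b k s) < e"
  proof eventually_elim
    case (elim n)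
    show ?case
    proof
      fix s assume s: "s \<in> U"
      have tail: "norm ((\<Sum>k. c k) - (\<Sum>k<N. c k)) \<le> e / 4"
        if c: "\<And>k. norm (c k) \<le> M k" for c :: "nat \<Rightarrow> complex"
      proof -
        have sc: "summable c" using M c by (intro summable_comparison_test[of c M]) auto
        have "norm (\<Sum>k. c (k + N)) \<le> (\<Sum>k. M (k + N))"
          using M c by (intro norm_suminf_le) auto
        then show ?thesis using suminf_split_initial_segment[OF sc, of N] N by (auto simp: algebra_simps)
      qed
      have "dist (\<Sum>k<N. a k n s) (\<Sum>k<N. b k s) < e / 4" using elim s by blast
      then show "dist (\<Sum>k. a k n s) (\<Sum>k. b k s) < e"
        using tail[of "\<lambda>k. a k n s", OF bound[OF s]] tail[of "\<lambda>k. b k s", OF bb[OF s]] e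
        unfolding dist_norm by norm
    qed
  qed
qed

section \<open>The weight \<open>(n + 1) powr (3/2)\<close> and families of series with coefficients
  of the inverse order\<close>

definition wt :: "nat \<Rightarrow> real" where
  "wt n = (real n + 1) powr (3/2)"

lemma wt_pos [simp]: "wt n > 0" and wt_nonneg [simp]: "wt n \<ge> 0"
  by (auto simp: wt_def)

lemma wt_ne [simp]: "wt n \<noteq> 0" by (simp add: wt_def)

lemma summable_inverse_wt: "summable (\<lambda>n. K / wt n)"
proof -
  have "summable (\<lambda>n. real n powr (-3/2))"
    by (subst summable_real_powr_iff) auto
  then have "summable (\<lambda>n. K * real (Suc n) powr (-3/2))"
    by (intro summable_mult) (subst summable_Suc_iff)
  then show ?thesis
    by (simp add: wt_def powr_minus_divide add.commute)
qed

text \<open>Trades the weight at \<open>n\<close> for the weight at a comparable index: products use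
  it with \<open>c = 2\<close>, powers with \<open>c = m + 1\<close> and
  \<open>c = (m + 1) / m\<close>.\<close>

lemma wt_scale:
  assumes "real n + 1 \<le> c * (real i + 1)" "c > 0"
  shows "wt n \<le> c powr (3/2) * wt i"
proof -
  have "wt n \<le> (c * (real i + 1)) powr (3/2)"
    unfolding wt_def using assms by (intro powr_mono2) auto
  then show ?thesis using assms by (simp add: wt_def powr_mult)
qed

lemma wt_ratio_tendsto: "(\<lambda>n. wt n / wt (n - k)) \<longlonglongrightarrow> 1"
proof -
  have "(\<lambda>n. (real n + 1) powr (3/2) / (real (n - k) + 1) powr (3/2)) \<longlonglongrightarrow> 1"
  proof (rule Lim_transform_eventually)
    show "(\<lambda>n. (real n + 1) powr (3/2) / (real n - real k + 1) powr (3/2)) \<longlonglongrightarrow> 1"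
      by real_asymp
    show "\<forall>\<^sub>F n in sequentially. (real n + 1) powr (3/2) / (real n - real k + 1) powr (3/2)
      = (real n + 1) powr (3/2) / (real (n - k) + 1) powr (3/2)"
      using eventually_ge_at_top[of k] by eventually_elim (simp add: of_nat_diff)
  qed
  then show ?thesis by (simp add: wt_def)
qed

text \<open>\<open>\<xi> s\<close> is the constant in front of \<open>n powr (-3/2)\<close>. It may
  be 0, so uniformly bounded polynomials of fixed degree and series with geometrically decaying
  coefficients belong to the class. The bound for all \<open>n\<close> is a separate clause because
  the uniform limit controls only large \<open>n\<close>, while products and compositions need a
  dominating sequence from the first coefficient on.\<close>

definition tame :: "'p set \<Rightarrow> ('p \<Rightarrow> complex fps) \<Rightarrow> ('p \<Rightarrow> complex) \<Rightarrow> bool" where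
  "tame U f \<xi> \<longleftrightarrow> (\<exists>K. \<forall>s\<in>U. \<forall>n. wt n * norm (f s $ n) \<le> K) \<and>
     uniform_limit U (\<lambda>n s. of_real (wt n) * f s $ n) \<xi> sequentially"

lemma tame_bound:
  assumes "tame U f \<xi>"
  obtains K where "K > 0" "\<And>s n. s \<in> U \<Longrightarrow> wt n * norm (f s $ n) \<le> K"
proof -
  obtain K where "\<forall>s\<in>U. \<forall>n. wt n * norm (f s $ n) \<le> K" using assms by (auto simp: tame_def)
  then show ?thesis by (intro that[of "max K 1"]) (auto simp: le_max_iff_disj)
qed

lemma tame_limit_bound:
  assumes f: "tame U f \<xi>" and K: "\<And>s n. s \<in> U \<Longrightarrow> wt n * norm (f s $ n) \<le> K" and s: "s \<in> U"
  shows "norm (\<xi> s) \<le> K"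
proof (rule tendsto_upperbound)
  have ul: "uniform_limit U (\<lambda>n s. of_real (wt n) * f s $ n) \<xi> sequentially"
    using f by (auto simp: tame_def)
  show "((\<lambda>n. norm (of_real (wt n) * f s $ n)) \<longlongrightarrow> norm (\<xi> s)) sequentially"
    by (intro tendsto_norm tendsto_uniform_limitI[OF ul s])
qed (use K[OF s] in \<open>auto simp: norm_mult\<close>)

lemma tame_subset: "tame U f \<xi> \<Longrightarrow> V \<subseteq> U \<Longrightarrow> tame V f \<xi>"
  unfolding tame_def by (meson subsetD uniform_limit_on_subset)

lemma tame_cong: "tame U f \<xi> \<Longrightarrow> (\<And>s. s \<in> U \<Longrightarrow> f s = g s) \<Longrightarrow> tame U g \<xi>"
  unfolding tame_def by (auto elim!: uniform_limit_transform)

lemma tame_diff: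
  assumes f: "tame U f \<xi>" and g: "tame U g \<eta>"
  shows "tame U (\<lambda>s. f s - g s) (\<lambda>s. \<xi> s - \<eta> s)"
proof -
  obtain K where K: "\<And>s n. s \<in> U \<Longrightarrow> wt n * norm (f s $ n) \<le> K" using tame_bound[OF f] by metis
  obtain L where L: "\<And>s n. s \<in> U \<Longrightarrow> wt n * norm (g s $ n) \<le> L" using tame_bound[OF g] by metis
  have "wt n * norm ((f s - g s) $ n) \<le> K + L" if "s \<in> U" for s n
  proof -
    have "wt n * norm ((f s - g s) $ n) \<le> wt n * (norm (f s $ n) + norm (g s $ n))"
      by (intro mult_left_mono) (auto intro: norm_triangle_ineq4)
    then show ?thesis using K[OF that, of n] L[OF that, of n] by (simp add: algebra_simps)
  qed
  moreover have "uniform_limit U (\<lambda>n s. of_real (wt n) * f s $ n - of_real (wt n) * g s $ n)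
    (\<lambda>s. \<xi> s - \<eta> s) sequentially"
    using f g by (intro uniform_limit_intros) (auto simp: tame_def)
  ultimately show ?thesis unfolding tame_def by (auto simp: algebra_simps)
qed

lemma tame_eventually_zero:
  assumes K: "\<And>s n. s \<in> U \<Longrightarrow> norm (f s $ n) \<le> K"
    and z: "\<And>s n. s \<in> U \<Longrightarrow> n > N \<Longrightarrow> f s $ n = 0"
  shows "tame U f (\<lambda>s. 0)"
proof -
  have "wt n * norm (f s $ n) \<le> wt N * \<bar>K\<bar>" if s: "s \<in> U" for s n
  proof (cases "n \<le> N")
    case True
    have "wt n \<le> wt N" using True unfolding wt_def by (intro powr_mono2) auto
    then show ?thesis using K[OF s, of n] by (intro mult_mono) auto
  qed (use z[OF s, of n] in auto)
  moreover have "uniform_limit U (\<lambda>n s. of_real (wt n) * f s $ n) (\<lambda>s. 0) sequentially"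
  proof (rule uniform_limitI)
    fix e :: real assume e: "e > 0"
    show "\<forall>\<^sub>F n in sequentially. \<forall>x\<in>U. dist (complex_of_real (wt n) * f x $ n) 0 < e"
      using eventually_gt_at_top[of N] by eventually_elim (use e in \<open>auto simp: z\<close>)
  qed
  ultimately show ?thesis unfolding tame_def by blast
qed

lemma tame_const:
  assumes "\<And>s. s \<in> U \<Longrightarrow> norm (c s) \<le> K"
  shows "tame U (\<lambda>s. fps_const (c s)) (\<lambda>s. 0)"
proof (rule tame_eventually_zero[where N = 0])
  show "norm (fps_const (c s) $ n) \<le> \<bar>K\<bar>" if "s \<in> U" for s n
    using assms[OF that] by auto
qed auto

text \<open>Since 3/2 > 1, the series still converge at the rescaled singularity 1, so their values
  there can enter the limits of products.\<close>

lemma tame_summable: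
  assumes f: "tame U f \<xi>" and s: "s \<in> U"
  shows "summable (\<lambda>n. norm (f s $ n))"
proof -
  obtain K where K: "\<And>s n. s \<in> U \<Longrightarrow> wt n * norm (f s $ n) \<le> K" using tame_bound[OF f] by metis
  have "norm (f s $ n) \<le> K / wt n" for n
    using K[OF s, of n] by (simp add: field_simps)
  then show ?thesis
    by (intro summable_comparison_test[OF _ summable_inverse_wt[of K]]) auto
qed

text \<open>
  In a convolution one of the two indices is at most \<open>n / 2\<close>; on each half the other factor can be
  replaced by its limit, by dominated convergence.
\<close>

lemma half_convolution:
  assumes f: "tame U f \<xi>" and g: "tame U g \<eta>"
    and I: "\<And>n. I n \<subseteq> {i. 2 * i \<le> n}" and ev: "\<And>i. \<forall>\<^sub>F n in sequentially. i \<in> I n"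
  shows "uniform_limit U (\<lambda>n s. \<Sum>i\<in>I n. of_real (wt n) * (f s $ i * g s $ (n - i)))
           (\<lambda>s. (\<Sum>i. f s $ i) * \<eta> s) sequentially"
    and "\<exists>B. \<forall>s\<in>U. \<forall>n. norm (\<Sum>i\<in>I n. of_real (wt n) * (f s $ i * g s $ (n - i))) \<le> B"
proof -
  obtain K where K: "K > 0" "\<And>s n. s \<in> U \<Longrightarrow> wt n * norm (f s $ n) \<le> K" using tame_bound[OF f] by metis
  obtain L where L: "L > 0" "\<And>s n. s \<in> U \<Longrightarrow> wt n * norm (g s $ n) \<le> L" using tame_bound[OF g] by metis
  have fin: "finite (I n)" for n by (rule finite_subset[OF I]) (auto intro: finite_subset[of _ "{..n}"])
  \<comment> \<open>Extension by zero turns the finite sums into series, the form that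
    \<open>uniform_tannery\<close> treats.\<close>
  define a where "a i n s = (if i \<in> I n then of_real (wt n) * (f s $ i * g s $ (n - i)) else 0)" for i n s
  \<comment> \<open>For \<open>2 * i \<le> n\<close> the weight of \<open>n\<close> is at most
    \<open>2 powr (3/2)\<close> times that of \<open>n - i\<close>, which leaves the summable factor
    \<open>1 / wt i\<close>.\<close>
  define M where "M i = (K * 2 powr (3/2) * L) / wt i" for i
  have M: "summable M" unfolding M_def by (rule summable_inverse_wt)
  have aM: "norm (a i n s) \<le> M i" if s: "s \<in> U" for i n s
  proof (cases "i \<in> I n")
    case True
    then have "2 * i \<le> n" using I by blast
    then have "wt n \<le> 2 powr (3/2) * wt (n - i)" by (intro wt_scale) (auto simp: of_nat_diff)
    then have "wt n * norm (g s $ (n - i)) \<le> 2 powr (3/2) * (wt (n - i) * norm (g s $ (n - i)))"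
      by (metis mult.assoc mult_right_mono norm_ge_zero)
    also have "\<dots> \<le> 2 powr (3/2) * L" using L(2)[OF s] by (intro mult_left_mono) auto
    finally have 1: "wt n * norm (g s $ (n - i)) \<le> 2 powr (3/2) * L" .
    have "wt i * norm (f s $ i) * (wt n * norm (g s $ (n - i))) \<le> K * (2 powr (3/2) * L)"
      using K L s by (intro mult_mono[OF K(2)[OF s] 1]) auto
    then show ?thesis using True by (simp add: a_def M_def norm_mult field_simps)
  qed (use K L in \<open>auto simp: a_def M_def\<close>)
  have sums: "(\<Sum>i. a i n s) = (\<Sum>i\<in>I n. of_real (wt n) * (f s $ i * g s $ (n - i)))" for n s
    by (subst suminf_finite[of "I n"]) (auto simp: a_def fin)
  have lim: "uniform_limit U (\<lambda>n s. a i n s) (\<lambda>s. f s $ i * \<eta> s) sequentially" for i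
  proof -
    have g': "uniform_limit U (\<lambda>n s. of_real (wt (n - i)) * g s $ (n - i)) \<eta> sequentially"
      using g filterlim_compose[of "\<lambda>n s. of_real (wt n) * g s $ n" _ sequentially "\<lambda>n. n - i" sequentially]
      unfolding tame_def by (auto intro: filterlim_minus_const_nat_at_top)
    have r: "uniform_limit U (\<lambda>n s. of_real (wt n / wt (n - i)) :: complex) (\<lambda>s. 1) sequentially"
    proof (rule uniform_limitI)
      fix e :: real assume "e > 0"
      from tendstoD[OF wt_ratio_tendsto this, of i]
      show "\<forall>\<^sub>F n in sequentially. \<forall>s\<in>U. dist (complex_of_real (wt n / wt (n - i))) 1 < e"
        by eventually_elim (metis dist_of_real of_real_1)
    qed
    have bf: "bounded ((\<lambda>s. f s $ i) ` U)"
      unfolding bounded_iff using K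
      by (auto intro!: exI[of _ "K / wt i"] simp: field_simps)
    have b\<eta>: "bounded (\<eta> ` U)"
      unfolding bounded_iff using tame_limit_bound[OF g L(2)] by auto
    have b1: "bounded ((\<lambda>s. 1 * \<eta> s) ` U)" "bounded ((\<lambda>s. 1::complex) ` U)"
      using b\<eta> by (auto simp: bounded_iff)
    have "uniform_limit U (\<lambda>n s. f s $ i * (of_real (wt n / wt (n - i)) * (of_real (wt (n - i)) * g s $ (n - i))))
        (\<lambda>s. f s $ i * (1 * \<eta> s)) sequentially"
      by (intro uniform_lim_mult r g' bf b\<eta> b1 uniform_limit_const)
    then have "uniform_limit U (\<lambda>n s. of_real (wt n) * (f s $ i * g s $ (n - i))) (\<lambda>s. f s $ i * \<eta> s) sequentially"
      by (simp add: mult_ac)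
    moreover have "\<forall>\<^sub>F n in sequentially. \<forall>s\<in>U. of_real (wt n) * (f s $ i * g s $ (n - i)) = a i n s"
      using ev[of i] by eventually_elim (auto simp: a_def)
    ultimately show ?thesis
      by (rule uniform_limit_transform) auto
  qed
  have "uniform_limit U (\<lambda>n s. \<Sum>i. a i n s) (\<lambda>s. \<Sum>i. f s $ i * \<eta> s) sequentially"
    by (rule uniform_tannery[OF lim aM M])
  then have *: "uniform_limit U (\<lambda>n s. \<Sum>i\<in>I n. of_real (wt n) * (f s $ i * g s $ (n - i)))
     (\<lambda>s. \<Sum>i. f s $ i * \<eta> s) sequentially" by (simp only: sums)
  show "uniform_limit U (\<lambda>n s. \<Sum>i\<in>I n. of_real (wt n) * (f s $ i * g s $ (n - i)))
     (\<lambda>s. (\<Sum>i. f s $ i) * \<eta> s) sequentially"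
    by (rule uniform_limit_transform[OF *])
       (auto intro!: suminf_mult2[symmetric] summable_norm_cancel tame_summable[OF f])
  have "norm (\<Sum>i\<in>I n. of_real (wt n) * (f s $ i * g s $ (n - i))) \<le> suminf M" if s: "s \<in> U" for s n
    unfolding sums[symmetric] by (rule norm_suminf_le[OF aM[OF s] M])
  then show "\<exists>B. \<forall>s\<in>U. \<forall>n. norm (\<Sum>i\<in>I n. of_real (wt n) * (f s $ i * g s $ (n - i))) \<le> B" by blast
qed

text \<open>The middle index \<open>i = n / 2\<close> goes to the first sum only, hence the strict
  inequality in the second. Reflecting \<open>i\<close> to \<open>n - i\<close> gives both sums the
  shape treated in \<open>half_convolution\<close>, with \<open>f\<close> and \<open>g\<close>
  exchanged.\<close>

lemma fps_mult_nth_halves: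
  fixes f g :: "complex fps"
  shows "(f * g) $ n = (\<Sum>i | 2 * i \<le> n. f $ i * g $ (n - i)) + (\<Sum>i | 2 * i < n. g $ i * f $ (n - i))"
proof -
  have "(f * g) $ n = (\<Sum>i\<in>{i. 2 * i \<le> n} \<union> {i. n < 2 * i \<and> i \<le> n}. f $ i * g $ (n - i))"
    unfolding fps_mult_nth by (rule sum.cong) auto
  also have "\<dots> = (\<Sum>i | 2 * i \<le> n. f $ i * g $ (n - i)) + (\<Sum>i | n < 2 * i \<and> i \<le> n. f $ i * g $ (n - i))"
    by (rule sum.union_disjoint) (auto intro: finite_subset[of _ "{..n}"])
  also have "(\<Sum>i | n < 2 * i \<and> i \<le> n. f $ i * g $ (n - i)) = (\<Sum>i | 2 * i < n. g $ i * f $ (n - i))"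
    by (rule sum.reindex_bij_witness[of _ "\<lambda>i. n - i" "\<lambda>i. n - i"]) auto
  finally show ?thesis .
qed

text \<open>The asymptotic constants obey a product rule: each half of the convolution contributes
  the value of one factor at 1 times the constant of the other.\<close>

lemma tame_mult:
  assumes f: "tame U f \<xi>" and g: "tame U g \<eta>"
  shows "tame U (\<lambda>s. f s * g s) (\<lambda>s. (\<Sum>i. f s $ i) * \<eta> s + (\<Sum>i. g s $ i) * \<xi> s)"
proof -
  let ?a = "\<lambda>n s. \<Sum>i | 2 * i \<le> n. complex_of_real (wt n) * (f s $ i * g s $ (n - i))"
  let ?b = "\<lambda>n s. \<Sum>i | 2 * i < n. complex_of_real (wt n) * (g s $ i * f s $ (n - i))"
  have ev: "\<forall>\<^sub>F n in sequentially. i \<in> {i. 2 * i \<le> n}" "\<forall>\<^sub>F n in sequentially. i \<in> {i. 2 * i < n}" for i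
    using eventually_ge_at_top[of "2 * i"] eventually_gt_at_top[of "2 * i"] by simp_all
  have sub: "{i. 2 * i \<le> n} \<subseteq> {i. 2 * i \<le> n}" "{i. 2 * i < n} \<subseteq> {i. 2 * i \<le> n}" for n :: nat by auto
  note A = half_convolution[OF f g sub(1) ev(1)]
  note B = half_convolution[OF g f sub(2) ev(2)]
  have eq: "of_real (wt n) * (f s * g s) $ n = ?a n s + ?b n s" for n s
    by (simp only: fps_mult_nth_halves sum_distrib_left distrib_left)
  from A(2) obtain K where K: "\<forall>s\<in>U. \<forall>n. norm (?a n s) \<le> K" ..
  from B(2) obtain L where L: "\<forall>s\<in>U. \<forall>n. norm (?b n s) \<le> L" ..
  have "wt n * norm ((f s * g s) $ n) \<le> K + L" if "s \<in> U" for s n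
  proof -
    have "wt n * norm ((f s * g s) $ n) = norm (?a n s + ?b n s)"
      unfolding eq[symmetric] by (simp add: norm_mult)
    also have "\<dots> \<le> norm (?a n s) + norm (?b n s)" by (rule norm_triangle_ineq)
    finally show ?thesis using K[rule_format, OF that, of n] L[rule_format, OF that, of n] by linarith
  qed
  moreover have "uniform_limit U (\<lambda>n s. of_real (wt n) * (f s * g s) $ n)
      (\<lambda>s. (\<Sum>i. f s $ i) * \<eta> s + (\<Sum>i. g s $ i) * \<xi> s) sequentially"
    unfolding eq by (rule uniform_limit_add[OF A(1) B(1)])
  ultimately show ?thesis unfolding tame_def by blast
qed

section \<open>Powers of a tame family and substitution into a power series\<close>

lemma convolution_partial_sum_le:
  fixes a b :: "nat \<Rightarrow> real"
  assumes "\<And>i. a i \<ge> 0" "\<And>i. b i \<ge> 0"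
  shows "(\<Sum>n\<le>N. \<Sum>i\<le>n. a i * b (n - i)) \<le> (\<Sum>i\<le>N. a i) * (\<Sum>i\<le>N. b i)"
proof -
  have "(\<Sum>n\<le>N. \<Sum>i\<le>n. a i * b (n - i)) = (\<Sum>(i,j)\<in>{(i,j). i + j \<le> N}. a i * b j)"
    by (rule sum.triangle_reindex_eq[symmetric])
  also have "\<dots> \<le> (\<Sum>(i,j)\<in>{..N} \<times> {..N}. a i * b j)"
    by (rule sum_mono2) (auto simp: assms)
  also have "\<dots> = (\<Sum>i\<le>N. a i) * (\<Sum>i\<le>N. b i)"
    by (simp add: sum_product sum.cartesian_product)
  finally show ?thesis .
qed

lemma norm_fps_mult_nth_le:
  fixes x y :: "complex fps"
  shows "norm ((x * y) $ n) \<le> (\<Sum>i\<le>n. norm (x $ i) * norm (y $ (n - i)))"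
  using norm_sum[of "\<lambda>i. x $ i * y $ (n - i)" "{0..n}"]
  by (simp add: fps_mult_nth norm_mult atMost_atLeast0)

text \<open>Partial sums of norms are submultiplicative, because the index pairs with
  \<open>i + j \<le> N\<close> lie in the square \<open>{..N} \<times> {..N}\<close>.\<close>

lemma fps_power_partial_l1:
  fixes x :: "complex fps"
  assumes r: "\<And>N. (\<Sum>n\<le>N. norm (x $ n)) \<le> r"
  shows "(\<Sum>n\<le>N. norm ((x ^ m) $ n)) \<le> r ^ m"
proof (induction m)
  case 0
  have "(\<Sum>n\<le>N. norm ((x ^ 0) $ n)) = (\<Sum>n\<in>{0::nat}. 1)"
    by (rule sum.mono_neutral_cong_right) auto
  then show ?case by simp
next
  case (Suc m)
  have r0: "r \<ge> 0" using r[of 0] order_trans[OF norm_ge_zero, of "x $ 0" r] by simp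
  have "(\<Sum>n\<le>N. norm ((x ^ Suc m) $ n)) \<le> (\<Sum>n\<le>N. \<Sum>i\<le>n. norm (x $ i) * norm ((x ^ m) $ (n - i)))"
    unfolding power_Suc by (rule sum_mono) (rule norm_fps_mult_nth_le)
  also have "\<dots> \<le> (\<Sum>i\<le>N. norm (x $ i)) * (\<Sum>i\<le>N. norm ((x ^ m) $ i))"
    by (rule convolution_partial_sum_le) auto
  also have "\<dots> \<le> r * r ^ m"
    by (rule mult_mono[OF r Suc r0]) (simp add: sum_nonneg)
  finally show ?case by simp
qed

text \<open>
  The induction step splits \<open>x * x ^ m\<close> at index \<open>(n + 1) / (m + 1)\<close>, in proportion to the number
  of factors on either side; this makes the constants add up exactly.
\<close>

lemma fps_power_coeff_bound:
  fixes x :: "complex fps"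
  assumes K: "\<And>n. wt n * norm (x $ n) \<le> K"
    and r: "\<And>N. (\<Sum>n\<le>N. norm (x $ n)) \<le> r" and m: "m \<ge> 1"
  shows "wt n * norm ((x ^ m) $ n) \<le> K * real m powr (5/2) * r ^ (m - 1)"
  using m
proof (induction m arbitrary: n rule: dec_induct)
  case base
  then show ?case using K by simp
next
  case (step m)
  have m: "real m > 0" using step by simp
  have K0: "K \<ge> 0" using K[of 0] by (smt (verit) mult_nonneg_nonneg norm_ge_zero wt_nonneg)
  have r0: "r \<ge> 0" using r[of 0] order_trans[OF norm_ge_zero, of "x $ 0" r] by simp
  define C where "C = K * real m powr (5/2) * r ^ (m - 1)"
  have C0: "C \<ge> 0" using K0 r0 by (simp add: C_def)
  have IH: "wt n * norm ((x ^ m) $ n) \<le> C" for n using step.IH by (simp add: C_def)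
  \<comment> \<open>The two factors from \<open>wt_scale\<close>: \<open>?S\<close> when the index
    \<open>i\<close> of \<open>x\<close> carries its proportional share of \<open>n\<close>,
    \<open>?T\<close> when the index of \<open>x ^ m\<close> does.\<close>
  let ?S = "(real m + 1) powr (3/2)" and ?T = "((real m + 1) / real m) powr (3/2)"
  have i_le: "wt n * (norm (x $ i) * norm ((x ^ m) $ (n - i)))
      \<le> ?S * K * norm ((x ^ m) $ (n - i)) + ?T * C * norm (x $ i)" if i: "i \<le> n" for i
  proof (cases "n + 1 \<le> (m + 1) * (i + 1)")
    case True
    then have "real (n + 1) \<le> real ((m + 1) * (i + 1))" by (simp only: of_nat_le_iff)
    then have "wt n \<le> ?S * wt i" by (intro wt_scale) (auto simp: algebra_simps)
    then have "wt n * norm (x $ i) \<le> ?S * (wt i * norm (x $ i))"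
      using mult_right_mono[OF _ norm_ge_zero[of "x $ i"]] by (simp only: mult.assoc[symmetric])
    also have "\<dots> \<le> ?S * K" using K by (intro mult_left_mono) auto
    finally have "wt n * norm (x $ i) * norm ((x ^ m) $ (n - i)) \<le> ?S * K * norm ((x ^ m) $ (n - i))"
      by (intro mult_right_mono) auto
    moreover have "?T * C * norm (x $ i) \<ge> 0" using C0 by simp
    ultimately show ?thesis by (simp add: mult_ac)
  next
    case False
    then have "(m + 1) * (i + 1) \<le> n + 1" by simp
    then have "real ((m + 1) * (i + 1)) \<le> real (n + 1)" by (simp only: of_nat_le_iff)
    then have "real m * (real n + 1) \<le> (real m + 1) * (real (n - i) + 1)"
      using i by (simp add: algebra_simps of_nat_diff)
    then have "wt n \<le> ?T * wt (n - i)" using m by (intro wt_scale) (auto simp: field_simps)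
    then have "wt n * norm ((x ^ m) $ (n - i)) \<le> ?T * (wt (n - i) * norm ((x ^ m) $ (n - i)))"
      using mult_right_mono[OF _ norm_ge_zero[of "(x ^ m) $ (n - i)"]] by (simp only: mult.assoc[symmetric])
    also have "\<dots> \<le> ?T * C" using IH by (intro mult_left_mono) auto
    finally have "wt n * norm ((x ^ m) $ (n - i)) * norm (x $ i) \<le> ?T * C * norm (x $ i)"
      by (intro mult_right_mono) auto
    moreover have "?S * K * norm ((x ^ m) $ (n - i)) \<ge> 0" using K0 by simp
    ultimately show ?thesis by (simp add: mult_ac)
  qed
  have "wt n * norm ((x ^ Suc m) $ n) \<le> wt n * (\<Sum>i\<le>n. norm (x $ i) * norm ((x ^ m) $ (n - i)))"
    unfolding power_Suc by (rule mult_left_mono[OF norm_fps_mult_nth_le]) simp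
  also have "\<dots> \<le> (\<Sum>i\<le>n. ?S * K * norm ((x ^ m) $ (n - i)) + ?T * C * norm (x $ i))"
    unfolding sum_distrib_left by (rule sum_mono) (rule i_le, simp)
  also have "\<dots> = ?S * K * (\<Sum>i\<le>n. norm ((x ^ m) $ (n - i))) + ?T * C * (\<Sum>i\<le>n. norm (x $ i))"
    by (simp only: sum.distrib sum_distrib_left)
  also have "(\<Sum>i\<le>n. norm ((x ^ m) $ (n - i))) = (\<Sum>i\<le>n. norm ((x ^ m) $ i))"
    by (rule sum.reindex_bij_witness[of _ "\<lambda>i. n - i" "\<lambda>i. n - i"]) auto
  also have "?S * K * (\<Sum>i\<le>n. norm ((x ^ m) $ i)) + ?T * C * (\<Sum>i\<le>n. norm (x $ i)) \<le> ?S * K * r ^ m + ?T * C * r"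
    using K0 C0 by (intro add_mono mult_left_mono fps_power_partial_l1[OF r] r) auto
  \<comment> \<open>The denominator of \<open>?T\<close> cancels against \<open>m powr (5/2)\<close>
    and leaves \<open>m\<close> copies of the first summand. Together they are \<open>m + 1\<close>
    copies, which raises the exponent of \<open>m + 1\<close> from 3/2 to 5/2.\<close>
  also have "?T * C * r = ?S * K * real m * r ^ m"
  proof -
    have "?T = ?S / real m powr (3/2)" using m by (simp add: powr_divide)
    moreover have "real m powr (5/2) = real m powr (3/2) * real m"
      using m powr_add[of "real m" "3/2" 1] by simp
    moreover have "r ^ (m - 1) * r = r ^ m" using m by (cases m) auto
    ultimately show ?thesis using m by (simp add: C_def)
  qed
  also have "?S * K * r ^ m + ?S * K * real m * r ^ m = K * (?S * (real m + 1)) * r ^ m"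
    by (simp add: algebra_simps)
  also have "?S * (real m + 1) = real (Suc m) powr (5/2)"
    using powr_add[of "real m + 1" "3/2" 1] by (simp add: add_ac)
  finally show ?case by simp
qed

lemma tame_power: "tame U f \<xi> \<Longrightarrow> \<exists>\<eta>. tame U (\<lambda>s. f s ^ m) \<eta>"
proof (induction m)
  case 0
  show ?case using tame_const[of U "\<lambda>_. 1" 1] by auto
next
  case (Suc m)
  then show ?case using tame_mult by (metis (no_types, lifting) power_Suc tame_cong)
qed

lemma summable_power_coeff_bound:
  assumes r: "0 \<le> r" "r < (1::real)"
  shows "summable (\<lambda>m. K * real m powr (5/2) * r ^ (m - 1))"
proof (cases "r = 0")
  case True
  then show ?thesis by (intro summable_finite[of "{0,1}"]) (auto simp: power_0_left)
next
  case False
  then have r: "0 < r" "r < 1" using r by auto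
  have "(\<lambda>m. K * real m powr (5/2) * r ^ (m - 1)) \<in> O(\<lambda>m. real m powr (-2))"
    using r by real_asymp
  then show ?thesis
    by (rule summable_comparison_test_bigo[rotated]) (simp add: summable_real_powr_iff)
qed

text \<open>\<open>uniform_tannery\<close> over the powers of \<open>f s\<close>: by
  \<open>fps_power_coeff_bound\<close> they are dominated by a multiple of
  \<open>m powr (5/2) * r ^ (m - 1)\<close>, summable for \<open>r < 1\<close>. Only the existence
  of a limit is recorded; its sign is settled later by counting.\<close>

lemma tame_compose:
  assumes f: "tame U f \<xi>" and \<phi>: "\<And>m. norm (\<phi> $ m) \<le> 1"
    and f0: "\<And>s. s \<in> U \<Longrightarrow> f s $ 0 = 0"
    and r: "r < 1" "\<And>s N. s \<in> U \<Longrightarrow> (\<Sum>n\<le>N. norm (f s $ n)) \<le> r"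
  shows "\<exists>\<eta>. tame U (\<lambda>s. \<phi> oo f s) \<eta>"
proof (cases "U = {}")
  case True
  then show ?thesis by (auto simp: tame_def)
next
  case False
  then obtain s0 where "s0 \<in> U" by blast
  from r(2)[OF this, of 0] have r0: "r \<ge> 0" using order_trans[OF norm_ge_zero, of "f s0 $ 0" r] by simp
  obtain K where K: "K > 0" "\<And>s n. s \<in> U \<Longrightarrow> wt n * norm (f s $ n) \<le> K" using tame_bound[OF f] by metis
  \<comment> \<open>The zeroth power is the series 1, whose only non-zero coefficient has weight
    \<open>wt 0 = 1\<close>.\<close>
  define M where "M m = (if m = 0 then 1 else K * real m powr (5/2) * r ^ (m - 1))" for m
  have "summable (\<lambda>m. K * real (Suc m) powr (5/2) * r ^ (Suc m - 1))"
    by (subst summable_Suc_iff) (rule summable_power_coeff_bound[OF r0 r(1)])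
  then have M: "summable M" by (subst summable_Suc_iff[symmetric]) (simp add: M_def)
  define a where "a m n s = of_real (wt n) * (\<phi> $ m * (f s ^ m) $ n)" for m n s
  have aM: "norm (a m n s) \<le> M m" if s: "s \<in> U" for m n s
  proof -
    have 1: "wt n * norm ((f s ^ m) $ n) \<le> M m"
    proof (cases "m = 0")
      case True
      then show ?thesis by (auto simp: M_def wt_def)
    next
      case False
      then show ?thesis using fps_power_coeff_bound[of "f s" K r m n] K(2)[OF s] r(2)[OF s] by (simp add: M_def)
    qed
    have "norm (a m n s) = norm (\<phi> $ m) * (wt n * norm ((f s ^ m) $ n))"
      by (simp add: a_def norm_mult)
    also have "\<dots> \<le> 1 * (wt n * norm ((f s ^ m) $ n))" using \<phi> by (intro mult_right_mono) auto
    finally show ?thesis using 1 by simp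
  qed
  obtain \<eta> where \<eta>: "\<And>m. tame U (\<lambda>s. f s ^ m) (\<eta> m)" using tame_power[OF f] by metis
  have lim: "uniform_limit U (\<lambda>n s. a m n s) (\<lambda>s. \<phi> $ m * \<eta> m s) sequentially" for m
  proof -
    have "uniform_limit U (\<lambda>n s. \<phi> $ m * (of_real (wt n) * (f s ^ m) $ n)) (\<lambda>s. \<phi> $ m * \<eta> m s) sequentially"
      using \<eta>[of m] by (intro uniform_limit_intros) (simp add: tame_def)
    then show ?thesis by (simp add: a_def mult_ac)
  qed
  have sums: "(\<Sum>m. a m n s) = of_real (wt n) * (\<phi> oo f s) $ n" if s: "s \<in> U" for n s
  proof -
    have "(\<Sum>m. a m n s) = (\<Sum>m\<in>{0..n}. a m n s)"
      using startsby_zero_power_prefix[OF f0[OF s]] by (intro suminf_finite) (auto simp: a_def)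
    then show ?thesis by (simp add: a_def fps_compose_nth sum_distrib_left)
  qed
  have "uniform_limit U (\<lambda>n s. \<Sum>m. a m n s) (\<lambda>s. \<Sum>m. \<phi> $ m * \<eta> m s) sequentially"
    by (rule uniform_tannery[OF lim aM M])
  then have "uniform_limit U (\<lambda>n s. of_real (wt n) * (\<phi> oo f s) $ n) (\<lambda>s. \<Sum>m. \<phi> $ m * \<eta> m s) sequentially"
    by (rule uniform_limit_transform) (auto simp: sums)
  moreover have "wt n * norm ((\<phi> oo f s) $ n) \<le> suminf M" if s: "s \<in> U" for s n
  proof -
    have "norm (of_real (wt n) * (\<phi> oo f s) $ n) \<le> suminf M"
      unfolding sums[OF s, symmetric] by (rule norm_suminf_le[OF aM[OF s] M])
    then show ?thesis by (simp add: norm_mult)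
  qed
  ultimately show ?thesis unfolding tame_def by blast
qed

section \<open>Generating functions of De Bruijn terms\<close>

definition terms_under :: "nat \<Rightarrow> nat \<Rightarrow> nat \<Rightarrow> lterm set" where
  "terms_under k L n = {t. closed_under L t \<and> (\<forall>i\<in>de_bruijn_indices t. i \<le> k) \<and> node_count t = n}"

lemma bounded_closed_terms_eq: "bounded_closed_terms k n = terms_under k 0 n"
  by (simp add: bounded_closed_terms_def terms_under_def closed_term_def)

lemma node_count_pos: "node_count t > 0"
  by (cases t) auto

lemma terms_under_0: "terms_under k L 0 = {}"
  using node_count_pos by (force simp: terms_under_def)

lemma terms_under_Suc:
  "terms_under k L (Suc n) = (if n = 0 then LVar ` {1..min L k} else {}) \<union> LAbs ` terms_under k (Suc L) n
     \<union> (\<Union>i\<le>n. (\<lambda>(s, t). LApp s t) ` (terms_under k L i \<times> terms_under k L (n - i)))" (is "?l = ?r")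
proof (intro equalityI subsetI)
  fix t assume "t \<in> ?l"
  then show "t \<in> ?r"
    by (cases t) (auto simp: terms_under_def image_iff)
next
  fix t assume "t \<in> ?r"
  then show "t \<in> ?l"
    by (auto simp: terms_under_def split: if_splits)
qed

lemma finite_terms_under: "finite (terms_under k L n)"
proof (induction n arbitrary: L rule: less_induct)
  case (less n)
  show ?case
  proof (cases n)
    case 0
    then show ?thesis by (simp add: terms_under_0)
  next
    case (Suc m)
    then show ?thesis using less by (auto simp: terms_under_Suc)
  qed
qed

text \<open>With all indices at most \<open>k\<close>, more than \<open>k\<close> enclosing
  abstractions offer no further binder. This closes the system of generating functions at level
  \<open>k\<close>.\<close>

lemma closed_under_saturate:
  assumes "\<forall>i\<in>de_bruijn_indices t. i \<le> k" "L \<ge> k"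
  shows "closed_under L t \<longleftrightarrow> closed_under k t"
  using assms
proof (induction t arbitrary: L)
  case (LAbs t)
  \<comment> \<open>The abstraction raises both \<open>L\<close> and \<open>k\<close>, so the
    induction hypothesis is used at \<open>Suc L\<close> and at \<open>Suc k\<close>.\<close>
  have "closed_under (Suc L) t \<longleftrightarrow> closed_under k t" "closed_under (Suc k) t \<longleftrightarrow> closed_under k t"
    using LAbs.IH[of "Suc L"] LAbs.IH[of "Suc k"] LAbs.prems by simp_all
  then show ?case by simp
next
  case (LApp t1 t2)
  show ?case using LApp.IH(1)[of L] LApp.IH(2)[of L] LApp.prems by simp
qed auto

lemma terms_under_saturate: "L \<ge> k \<Longrightarrow> terms_under k L n = terms_under k k n"
  using closed_under_saturate unfolding terms_under_def by blast

text \<open>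
  The leaf variable is written as \<open>u = exp s\<close>, so that \<open>\<surd>u = exp (s / 2)\<close> is entire.
\<close>

definition leaf_poly :: "nat \<Rightarrow> nat \<Rightarrow> nat \<Rightarrow> complex \<Rightarrow> complex" where
  "leaf_poly k L n s = (\<Sum>t\<in>terms_under k L n. exp (s * of_nat (leaf_count t)))"

lemma leaf_poly_0 [simp]: "leaf_poly k L 0 s = 0"
  by (simp add: leaf_poly_def terms_under_0)

lemma leaf_poly_Suc:
  "leaf_poly k L (Suc n) s = (if n = 0 then of_nat (min L k) * exp s else 0) + leaf_poly k (Suc L) n s
     + (\<Sum>i\<le>n. leaf_poly k L i s * leaf_poly k L (n - i) s)"
proof -
  let ?w = "\<lambda>t. exp (s * of_nat (leaf_count t))"
  let ?V = "if n = 0 then LVar ` {1..min L k} else {}"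
  let ?B = "\<lambda>i. (\<lambda>(s, t). LApp s t) ` (terms_under k L i \<times> terms_under k L (n - i))"
  have "leaf_poly k L (Suc n) s = sum ?w (?V \<union> LAbs ` terms_under k (Suc L) n) + sum ?w (\<Union>i\<le>n. ?B i)"
    unfolding leaf_poly_def terms_under_Suc
    by (rule sum.union_disjoint) (auto simp: finite_terms_under split: if_splits)
  also have "sum ?w (?V \<union> LAbs ` terms_under k (Suc L) n) = sum ?w ?V + sum ?w (LAbs ` terms_under k (Suc L) n)"
    by (rule sum.union_disjoint) (auto simp: finite_terms_under split: if_splits)
  also have "sum ?w ?V = (if n = 0 then of_nat (min L k) * exp s else 0)"
    by (auto simp: sum.reindex inj_on_def)
  also have "sum ?w (LAbs ` terms_under k (Suc L) n) = leaf_poly k (Suc L) n s"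
    by (auto simp: sum.reindex inj_on_def leaf_poly_def)
  also have "sum ?w (\<Union>i\<le>n. ?B i) = (\<Sum>i\<le>n. sum ?w (?B i))"
    by (rule sum.UNION_disjoint) (simp_all add: finite_terms_under, auto simp: terms_under_def)
  also have "\<dots> = (\<Sum>i\<le>n. leaf_poly k L i s * leaf_poly k L (n - i) s)"
  proof (rule sum.cong[OF refl])
    fix i
    have "sum ?w (?B i) = (\<Sum>(a,b)\<in>terms_under k L i \<times> terms_under k L (n - i). ?w a * ?w b)"
      by (subst sum.reindex)
         (auto simp: inj_on_def exp_add distrib_left intro!: sum.cong)
    then show "sum ?w (?B i) = leaf_poly k L i s * leaf_poly k L (n - i) s"
      by (simp add: leaf_poly_def sum_product sum.cartesian_product)
  qed
  finally show ?thesis by simp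
qed

lemma leaf_poly_saturate: "leaf_poly k (Suc k) n s = leaf_poly k k n s"
  using terms_under_saturate[of k "Suc k" n] by (simp add: leaf_poly_def)

text \<open>
  The inverse of the dominant singularity in \<open>z\<close>.
\<close>

definition lam :: "nat \<Rightarrow> complex \<Rightarrow> complex" where
  "lam k s = 1 + 2 * of_real (sqrt (real k)) * exp (s / 2)"

text \<open>On the unit disc \<open>Im s / 2\<close> stays within the range where the cosine is
  positive. Hence \<open>lam\<close> has no zero there, and its quotients by the positive number
  \<open>lam k 0\<close> avoid the branch cut of \<open>Ln\<close>.\<close>

lemma Re_lam_ge_1:
  assumes "s \<in> ball 0 1"
  shows "Re (lam k s) \<ge> 1"
proof -
  have "\<bar>Im s\<bar> < 1" using assms abs_Im_le_cmod[of s] by simp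
  then have "cos (Im s / 2) > 0" using pi_gt3 by (intro cos_gt_zero_pi) auto
  then show ?thesis by (simp add: lam_def Re_exp Im_exp)
qed

lemma norm_lam_ge_1: "s \<in> ball 0 1 \<Longrightarrow> norm (lam k s) \<ge> 1"
  using Re_lam_ge_1[of s k] complex_Re_le_cmod[of "lam k s"] by linarith

lemma lam_0: "lam k 0 = of_real (1 + 2 * sqrt (real k))"
  by (simp add: lam_def)

lemma lam_nonzero: "s \<in> ball 0 1 \<Longrightarrow> lam k s \<noteq> 0"
  using norm_lam_ge_1[of s k] by auto

section \<open>Rescaled generating functions and their quadratic equations\<close>

definition term_gf :: "nat \<Rightarrow> nat \<Rightarrow> complex \<Rightarrow> complex fps" where
  "term_gf k L s = Abs_fps (\<lambda>n. leaf_poly k L n s / lam k s ^ n)"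

text \<open>The size variable \<open>z\<close> after the rescaling that moves the dominant
  singularity to 1 for every \<open>s\<close>, so that one weight \<open>wt\<close> serves the whole
  family.\<close>

definition scaled_X :: "nat \<Rightarrow> complex \<Rightarrow> complex fps" where
  "scaled_X k s = fps_const (1 / lam k s) * fps_X"

lemma fps_const_X_mult_nth:
  fixes f :: "complex fps"
  shows "(fps_const c * fps_X * f) $ n = (if n = 0 then 0 else c * f $ (n - 1))"
  by (subst mult.assoc) simp

lemma term_gf_nth_Suc:
  assumes "lam k s \<noteq> 0"
  shows "term_gf k L s $ Suc n = 1 / lam k s * (fps_const (of_nat (min L k) * exp s) + term_gf k (Suc L) s + term_gf k L s * term_gf k L s) $ n"
proof -
  have "(term_gf k L s * term_gf k L s) $ n = (\<Sum>i\<le>n. leaf_poly k L i s * leaf_poly k L (n - i) s / lam k s ^ n)"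
    unfolding fps_mult_nth atMost_atLeast0
    by (rule sum.cong) (use assms in \<open>auto simp: term_gf_def power_add[symmetric]\<close>)
  then show ?thesis
    by (auto simp: term_gf_def leaf_poly_Suc add_divide_distrib sum_divide_distrib mult.commute)
qed

lemma term_gf_eq:
  assumes "lam k s \<noteq> 0"
  shows "term_gf k L s = scaled_X k s * (fps_const (of_nat (min L k) * exp s) + term_gf k (Suc L) s + term_gf k L s * term_gf k L s)"
proof (rule fps_ext)
  fix n
  show "term_gf k L s $ n = (scaled_X k s * (fps_const (of_nat (min L k) * exp s) + term_gf k (Suc L) s + term_gf k L s * term_gf k L s)) $ n"
    unfolding scaled_X_def fps_const_X_mult_nth
    using term_gf_nth_Suc[OF assms] by (cases n) (simp_all add: term_gf_def)
qed

text \<open>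
  The function \<open>2 z B\<^sub>L\<close>, for which solving the quadratic equation of \<open>B\<^sub>L\<close> needs no division by \<open>z\<close>.
\<close>

definition level_gf :: "nat \<Rightarrow> nat \<Rightarrow> complex \<Rightarrow> complex fps" where
  "level_gf k L s = 2 * scaled_X k s * term_gf k L s"

text \<open>Completing the square in \<open>g = z * (c + g' + g * g)\<close>, multiplied by
  \<open>4 * z\<close>.\<close>

lemma level_gf_square:
  assumes "lam k s \<noteq> 0" "L \<le> k"
  shows "(1 - level_gf k L s)^2 = 1 - (4 * scaled_X k s ^ 2 * (fps_const (of_nat L * exp s) + term_gf k (Suc L) s))"
proof -
  define z g g' c where "z = scaled_X k s" and "g = term_gf k L s" and "g' = term_gf k (Suc L) s"
    and "c = fps_const (of_nat L * exp s)"
  have "g = z * (c + g' + g * g)" 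
    using term_gf_eq[OF assms(1), of L] assms(2) by (simp add: z_def g_def g'_def c_def min_def)
  then have "(1 - 2 * z * g)^2 = 1 - 4 * z^2 * (c + g')" by algebra
  then show ?thesis by (simp add: level_gf_def z_def g_def g'_def c_def)
qed

text \<open>At level \<open>k\<close> the unknown also stands for the next level, so the completed
  square is \<open>(1 - z)^2 - z^2 * a^2\<close> with \<open>a = lam - 1\<close>, the value
  \<open>2 * sqrt (k * u)\<close> for \<open>u = exp s\<close>. It splits into linear factors, and
  \<open>z * (1 + a)\<close> is exactly \<open>fps_X\<close>.\<close>

lemma level_gf_square_top:
  assumes "lam k s \<noteq> 0"
  shows "(1 - scaled_X k s - level_gf k k s)^2
     = (1 - fps_X) * (1 - fps_const ((2 - lam k s) / lam k s) * fps_X)"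
proof -
  define z g c where "z = scaled_X k s" and "g = term_gf k k s" and "c = fps_const (of_nat k * exp s)"
  define a where "a = fps_const (lam k s - 1)"
  have gg: "term_gf k (Suc k) s = g" by (simp add: g_def term_gf_def leaf_poly_saturate)
  have g: "g = z * (c + g + g * g)" 
    using term_gf_eq[OF assms(1), of k] gg by (simp add: z_def g_def c_def)
  have "exp (s / 2) ^ 2 = exp s" by (simp add: power2_eq_square exp_add[symmetric])
  moreover have "complex_of_real (sqrt (real k)) ^ 2 = of_nat k"
    by (metis of_nat_0_le_iff of_real_of_nat_eq of_real_power real_sqrt_pow2)
  ultimately have "(lam k s - 1)^2 = 4 * (of_nat k * exp s)"
    by (simp add: lam_def power_mult_distrib)
  then have a2: "a ^ 2 = 4 * c" by (simp add: a_def c_def fps_const_power flip: fps_const_mult numeral_fps_const)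
  have za: "z * (1 + a) = fps_X"
  proof -
    have "1 + a = fps_const (lam k s)" by (simp add: a_def flip: fps_const_1_eq_1)
    then show ?thesis using assms by (simp add: z_def scaled_X_def mult_ac)
  qed
  have zb: "z * (1 - a) = fps_const ((2 - lam k s) / lam k s) * fps_X"
  proof -
    have "1 - a = fps_const (2 - lam k s)" by (simp add: a_def flip: fps_const_1_eq_1)
    then show ?thesis using assms by (simp add: z_def scaled_X_def mult_ac)
  qed
  have "(1 - z - 2 * z * g)^2 = (1 - z * (1 + a)) * (1 - z * (1 - a))"
    using g a2 by algebra
  then show ?thesis unfolding za zb by (simp add: level_gf_def z_def g_def)
qed

text \<open>The constant coefficient 1 selects the branch of the square root.\<close>

lemma fps_square_eq_imp_eq:
  fixes f g :: "complex fps"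
  assumes "f ^ 2 = g ^ 2" "f $ 0 = 1" "g $ 0 = 1"
  shows "f = g"
proof -
  have "f = g \<or> f = - g" using assms(1) by (simp add: power2_eq_iff)
  moreover have "f \<noteq> - g" using assms(2,3) by auto
  ultimately show ?thesis by blast
qed

lemma level_gf_nth_0 [simp]: "level_gf k L s $ 0 = 0"
  by (simp add: level_gf_def scaled_X_def)

lemma level_gf_nth: "level_gf k L s $ Suc n = 2 * leaf_poly k L n s / lam k s ^ Suc n"
proof -
  have "level_gf k L s = fps_const (2 / lam k s) * fps_X * term_gf k L s"
    by (simp add: level_gf_def scaled_X_def mult_ac numeral_fps_const)
  then show ?thesis by (simp add: fps_const_X_mult_nth term_gf_def)
qed

text \<open>Successive coefficients have ratio \<open>(1/2 - n) / (n + 1)\<close>, of modulus at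
  most 1. This supplies the hypothesis on the outer series in \<open>tame_compose\<close>.\<close>

lemma norm_half_gchoose_le: "norm ((1/2 :: complex) gchoose n) \<le> 1"
proof (induction n)
  case (Suc n)
  have "norm (1/2 - of_nat n :: complex) \<le> 1/2 + real n"
    using norm_triangle_ineq4[of "1/2 :: complex" "of_nat n"] by simp
  then have "norm ((1/2 - of_nat n) / of_nat (Suc n) :: complex) \<le> 1"
    by (simp add: norm_divide divide_le_eq del: of_nat_Suc)
  then have "norm ((1/2 :: complex) gchoose n) * norm ((1/2 - of_nat n) / of_nat (Suc n) :: complex) \<le> 1"
    using Suc by (intro mult_le_one) auto
  moreover have "(1/2 :: complex) gchoose Suc n = ((1/2) gchoose n) * ((1/2 - of_nat n) / of_nat (Suc n))"
    using gbinomial_mult_1[of "1/2 :: complex" n] by (simp add: field_simps del: of_nat_Suc)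
  ultimately show ?case by (simp only: norm_mult)
qed auto

section \<open>Singular behaviour at every level\<close>

definition sqrt_fps :: "complex \<Rightarrow> complex fps" where
  "sqrt_fps c = Abs_fps (\<lambda>n. (-c) ^ n * (1/2 gchoose n))"

lemma sqrt_fps_0 [simp]: "sqrt_fps c $ 0 = 1"
  by (simp add: sqrt_fps_def)

lemma norm_sqrt_fps_1_le: "norm (sqrt_fps 1 $ n) \<le> 1"
  using norm_half_gchoose_le[of n] by (simp add: sqrt_fps_def norm_mult norm_power)

lemma sqrt_fps_square: "sqrt_fps c ^ 2 = 1 - fps_const c * fps_X"
proof -
  have eq: "sqrt_fps c = fps_binomial (1/2) oo (fps_const (-c) * fps_X)"
    unfolding fps_compose_linear by (simp add: sqrt_fps_def)
  have "sqrt_fps c ^ 2 = (fps_binomial (1/2) * fps_binomial (1/2)) oo (fps_const (-c) * fps_X)"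
    unfolding eq power2_eq_square by (rule fps_compose_mult_distrib[symmetric]) simp
  also have "fps_binomial (1/2) * fps_binomial (1/2) = (1 + fps_X :: complex fps)"
    by (simp flip: fps_binomial_add_mult add: fps_binomial_1)
  also have "(1 + fps_X) oo (fps_const (-c) * fps_X) = 1 - fps_const c * fps_X"
    by (simp add: fps_compose_add_distrib flip: fps_const_neg)
  finally show ?thesis .
qed

lemma sqrt_fps_compose_square:
  assumes "x $ 0 = 0"
  shows "(sqrt_fps 1 oo x) ^ 2 = 1 - x"
proof -
  have "(sqrt_fps 1 oo x) ^ 2 = (sqrt_fps 1 ^ 2) oo x"
    unfolding power2_eq_square by (rule fps_compose_mult_distrib[symmetric, OF assms])
  then show ?thesis using assms by (simp add: sqrt_fps_square fps_compose_sub_distrib)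
qed

text \<open>\<open>gbinomial_asymptotic\<close> at exponent 1/2; its alternating sign cancels the
  one in \<open>sqrt_fps 1\<close>, and passing from \<open>n\<close> to \<open>n + 1\<close> in the
  weight does not change the limit.\<close>

lemma tame_sqrt_fps_1: "tame U (\<lambda>s. sqrt_fps 1) (\<lambda>s. inverse (Gamma (- (1/2))))"
proof -
  define a where "a n = of_real (wt n) * sqrt_fps 1 $ n" for n
  have "(\<lambda>n. (1/2 gchoose n) / ((-1)^n / exp ((1/2+1) * of_real (ln (real n))))) \<longlonglongrightarrow> inverse (Gamma (- (1/2) :: complex))"
    by (rule gbinomial_asymptotic)
  moreover have "(\<lambda>n. complex_of_real (wt n / real n powr (3/2))) \<longlonglongrightarrow> of_real 1"
    unfolding wt_def by (intro tendsto_of_real) real_asymp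
  ultimately have "(\<lambda>n. (1/2 gchoose n) / ((-1)^n / exp ((1/2+1) * of_real (ln (real n)))) * of_real (wt n / real n powr (3/2)))
      \<longlonglongrightarrow> inverse (Gamma (- (1/2) :: complex)) * of_real 1"
    by (rule tendsto_mult)
  moreover have "\<forall>\<^sub>F n in sequentially. (1/2 gchoose n) / ((-1)^n / exp ((1/2+1) * of_real (ln (real n)))) * of_real (wt n / real n powr (3/2)) = a n"
    using eventually_gt_at_top[of 0]
  proof eventually_elim
    case (elim n)
    have e: "exp ((1/2+1) * of_real (ln (real n))) = complex_of_real (real n powr (3/2))"
      using elim by (simp add: powr_def exp_of_real[symmetric])
    have "(1::complex) / (-1)^n = (-1)^n" by (cases "even n") auto
    then show ?case unfolding e using elim by (simp add: a_def sqrt_fps_def field_simps)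
  qed
  ultimately have lim: "a \<longlonglongrightarrow> inverse (Gamma (- (1/2)))"
    using Lim_transform_eventually by fastforce
  then have "Bseq a" by (intro convergent_imp_Bseq) (auto simp: convergent_def)
  then obtain K where "\<And>n. norm (a n) \<le> K" by (auto simp: Bseq_def)
  then have "wt n * norm (sqrt_fps 1 $ n) \<le> K" for n by (simp add: a_def norm_mult)
  moreover have "uniform_limit U (\<lambda>n s. of_real (wt n) * sqrt_fps 1 $ n) (\<lambda>s. inverse (Gamma (- (1/2)))) sequentially"
  proof (rule uniform_limitI)
    fix e :: real assume "e > 0"
    from tendstoD[OF lim this]
    show "\<forall>\<^sub>F n in sequentially. \<forall>s\<in>U. dist (of_real (wt n) * sqrt_fps 1 $ n) (inverse (Gamma (- (1/2)))) < e"
      by (rule eventually_mono) (simp add: a_def)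
  qed
  ultimately show ?thesis unfolding tame_def by blast
qed

text \<open>The coefficients are at most \<open>q0 ^ n\<close>, which beats the polynomial weight
  uniformly in the parameter.\<close>

lemma tame_sqrt_fps_small:
  assumes q: "\<And>s. s \<in> U \<Longrightarrow> norm (q s) \<le> q0" and q0: "0 < q0" "q0 < 1"
  shows "tame U (\<lambda>s. sqrt_fps (q s)) (\<lambda>s. 0)"
proof -
  have bd: "wt n * norm (sqrt_fps (q s) $ n) \<le> wt n * q0 ^ n" if "s \<in> U" for s n
  proof -
    have "norm (q s) ^ n * norm ((1/2 :: complex) gchoose n) \<le> q0 ^ n * 1"
      using q[OF that] q0 norm_half_gchoose_le by (intro mult_mono power_mono) auto
    then show ?thesis by (intro mult_left_mono) (simp_all add: sqrt_fps_def norm_mult norm_power)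
  qed
  have lim: "(\<lambda>n. wt n * q0 ^ n) \<longlonglongrightarrow> 0"
    unfolding wt_def using q0 by real_asymp
  then have "Bseq (\<lambda>n. wt n * q0 ^ n)" by (intro convergent_imp_Bseq) (auto simp: convergent_def)
  then obtain K where K': "\<And>n. norm (wt n * q0 ^ n) \<le> K" by (auto simp: Bseq_def)
  have K: "wt n * q0 ^ n \<le> K" for n using K'[of n] by (simp only: real_norm_def abs_le_iff)
  have "uniform_limit U (\<lambda>n s. of_real (wt n) * sqrt_fps (q s) $ n) (\<lambda>s. 0) sequentially"
  proof (rule uniform_limitI)
    fix e :: real assume e: "e > 0"
    from order_tendstoD(2)[OF lim e]
    show "\<forall>\<^sub>F n in sequentially. \<forall>s\<in>U. dist (of_real (wt n) * sqrt_fps (q s) $ n) 0 < e"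
    proof (rule eventually_mono)
      fix n assume n: "wt n * q0 ^ n < e"
      show "\<forall>s\<in>U. dist (of_real (wt n) * sqrt_fps (q s) $ n) 0 < e"
      proof
        fix s assume "s \<in> U"
        from le_less_trans[OF bd[OF this] n]
        show "dist (of_real (wt n) * sqrt_fps (q s) $ n) 0 < e" by (simp add: norm_mult)
      qed
    qed
  qed
  moreover have "wt n * norm (sqrt_fps (q s) $ n) \<le> K" if "s \<in> U" for s n
    using bd[OF that] K by (rule order_trans)
  ultimately show ?thesis unfolding tame_def by blast
qed

section \<open>The square-root singularity at level \<open>k\<close>\<close>

lemma tame_scaled_X: "tame (ball 0 1) (scaled_X k) (\<lambda>s. 0)"
proof (rule tame_eventually_zero[where N = 1 and K = 1])
  fix s :: complex and n :: nat assume s: "s \<in> ball 0 1"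
  show "norm (scaled_X k s $ n) \<le> 1"
    using norm_lam_ge_1[OF s, of k] by (auto simp: scaled_X_def norm_divide fps_X_def divide_le_eq)
qed (auto simp: scaled_X_def fps_X_def)

lemma continuous_lam: "continuous_on A (lam k)"
  unfolding lam_def by (intro continuous_intros) auto

lemma isCont_lam: "isCont (lam k) s"
  using continuous_lam[of UNIV k] by (simp add: continuous_on_eq_continuous_at)

text \<open>At \<open>s = 0\<close> the ratio is \<open>(1 - 2 * r) / (1 + 2 * r)\<close> with
  \<open>r = sqrt k\<close>, of modulus below 1, and continuity extends this to a disc. Thus the
  second factor in \<open>level_gf_square_top\<close> has no zero near the closed unit disc.\<close>

lemma sub_ratio_bound:
  assumes "k \<ge> 1"
  obtains \<delta> q0 where "0 < \<delta>" "\<delta> \<le> 1" "0 < q0" "q0 < 1"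
    "\<And>s. s \<in> ball 0 \<delta> \<Longrightarrow> norm ((2 - lam k s) / lam k s) \<le> q0"
proof -
  define q where "q s = norm ((2 - lam k s) / lam k s)" for s
  have "real k \<ge> 1" using assms by simp
  then have sk: "sqrt (real k) \<ge> 1" by simp
  have "(2 - lam k 0) / lam k 0 = of_real ((1 - 2 * sqrt (real k)) / (1 + 2 * sqrt (real k)))"
    by (simp add: lam_0)
  then have "q 0 = \<bar>(1 - 2 * sqrt (real k)) / (1 + 2 * sqrt (real k))\<bar>" unfolding q_def by (simp only: norm_of_real)
  also have "\<dots> < 1"
  proof -
    have "\<bar>1 - 2 * sqrt (real k)\<bar> < \<bar>1 + 2 * sqrt (real k)\<bar>" using sk by linarith
    then show ?thesis by (simp add: abs_divide divide_less_eq)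
  qed
  finally have q1: "q 0 < 1" .
  \<comment> \<open>The midpoint between \<open>q 0\<close> and 1 leaves room for the continuity
    argument.\<close>
  define q0 where "q0 = (1 + q 0) / 2"
  have q00: "q 0 < q0" "q0 < 1" "q0 > 0" using q1 by (auto simp: q0_def q_def add_pos_nonneg)
  have "isCont q 0" unfolding q_def
    by (intro continuous_intros isCont_lam) (simp_all add: lam_nonzero)
  then have "\<forall>\<^sub>F s in nhds 0. q s < q0"
    using q00(1) by (intro order_tendstoD) (auto simp: isCont_def tendsto_nhds_iff)
  then obtain d where d: "d > 0" "\<And>s. dist s 0 < d \<Longrightarrow> q s < q0"
    by (auto simp: eventually_nhds_metric)
  show ?thesis
    by (rule that[of "min d 1" q0]) (use d q00 in \<open>auto simp: q_def dist_commute less_imp_le\<close>)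
qed

text \<open>The square root of \<open>level_gf_square_top\<close> is
  \<open>sqrt_fps 1 * sqrt_fps (q s)\<close>: the first factor carries the singularity, and the
  second only multiplies its constant by its own value at 1.\<close>

lemma tame_level_gf_top:
  assumes "k \<ge> 1"
  shows "\<exists>\<delta> \<xi>. 0 < \<delta> \<and> \<delta> \<le> 1 \<and> tame (ball 0 \<delta>) (level_gf k k) \<xi> \<and> \<xi> 0 \<noteq> 0"
proof -
  obtain \<delta> q0 where d: "0 < \<delta>" "\<delta> \<le> 1" "0 < q0" "q0 < 1"
    and q: "\<And>s. s \<in> ball 0 \<delta> \<Longrightarrow> norm ((2 - lam k s) / lam k s) \<le> q0"
    by (rule sub_ratio_bound[OF assms]) blast
  define U where "U = ball (0::complex) \<delta>"
  define q where "q s = (2 - lam k s) / lam k s" for s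
  let ?G = "inverse (Gamma (- (1/2) :: complex))"
  have q': "norm (q s) \<le> q0" if "s \<in> U" for s using q that by (simp add: q_def U_def)
  have U1: "U \<subseteq> ball 0 1" using d by (auto simp: U_def)
  have t: "tame U (\<lambda>s. sqrt_fps 1 * sqrt_fps (q s)) (\<lambda>s. (\<Sum>i. sqrt_fps 1 $ i) * 0 + (\<Sum>i. sqrt_fps (q s) $ i) * ?G)"
    by (intro tame_mult tame_sqrt_fps_1 tame_sqrt_fps_small[of _ _ q0] q' d)
  have c: "tame U (\<lambda>s. fps_const 1) (\<lambda>s. 0)" by (rule tame_const[of _ _ 1]) auto
  have eq: "1 - scaled_X k s - level_gf k k s = sqrt_fps 1 * sqrt_fps (q s)" if s: "s \<in> U" for s
  proof (rule fps_square_eq_imp_eq)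
    have "lam k s \<noteq> 0" using s U1 lam_nonzero by blast
    from level_gf_square_top[OF this]
    show "(1 - scaled_X k s - level_gf k k s)\<^sup>2 = (sqrt_fps 1 * sqrt_fps (q s))\<^sup>2"
      by (simp add: power_mult_distrib sqrt_fps_square q_def)
  qed (simp_all add: scaled_X_def)
  have "tame U (\<lambda>s. (fps_const 1 - scaled_X k s) - sqrt_fps 1 * sqrt_fps (q s))
      (\<lambda>s. (0 - 0) - ((\<Sum>i. sqrt_fps 1 $ i) * 0 + (\<Sum>i. sqrt_fps (q s) $ i) * ?G))"
    by (intro tame_diff c t tame_subset[OF tame_scaled_X U1])
  then have T: "tame U (level_gf k k) (\<lambda>s. (0 - 0) - ((\<Sum>i. sqrt_fps 1 $ i) * 0 + (\<Sum>i. sqrt_fps (q s) $ i) * ?G))"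
    by (rule tame_cong) (simp add: eq[symmetric])
  \<comment> \<open>Inside its disc of convergence the binomial series sums to
    \<open>sqrt (1 - q 0)\<close>, which is non-zero.\<close>
  have n: "norm (- q 0) < 1" using q'[of 0] d by (simp add: U_def)
  have "(\<Sum>i. sqrt_fps (q 0) $ i) = (1 + - q 0) powr (1/2)"
    using sums_unique[OF gen_binomial_complex[OF n, of "1/2"]] by (simp add: sqrt_fps_def mult.commute)
  moreover have "q 0 \<noteq> 1" using n by auto
  ultimately have "(\<Sum>i. sqrt_fps (q 0) $ i) \<noteq> 0" by simp
  moreover have "?G \<noteq> 0"
  proof -
    \<comment> \<open>By convention \<open>Gamma\<close> is 0 at its poles, the non-positive
      integers, and it is non-zero everywhere else.\<close>
    have "- (1/2) \<notin> (\<int>\<^sub>\<le>\<^sub>0 :: complex set)"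
    proof
      assume "- (1/2) \<in> (\<int>\<^sub>\<le>\<^sub>0 :: complex set)"
      then obtain n where "- (1/2) = (- of_nat n :: complex)" by (auto elim: nonpos_Ints_cases')
      then have "of_nat (2 * n) = (of_nat 1 :: complex)" by (simp add: field_simps)
      then have "2 * n = 1" by (simp only: of_nat_eq_iff)
      then show False by presburger
    qed
    then show ?thesis by (simp add: Gamma_eq_zero_iff)
  qed
  ultimately show ?thesis using T d unfolding U_def by (intro exI conjI) (assumption | simp del: mult_zero_right)+
qed

section \<open>Descent from level \<open>k\<close> to level 0\<close>

lemma uniform_partial_l1_near:
  assumes f: "tame U f \<xi>" and U: "open U" "p \<in> U" and cont: "\<And>n. isCont (\<lambda>s. f s $ n) p"
    and S: "\<And>N. (\<Sum>n\<le>N. norm (f p $ n)) \<le> S" and Sr: "S < r"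
  shows "\<exists>\<delta>>0. ball p \<delta> \<subseteq> U \<and> (\<forall>s\<in>ball p \<delta>. \<forall>N. (\<Sum>n\<le>N. norm (f s $ n)) \<le> r)"
proof -
  obtain K where K: "K > 0" "\<And>s n. s \<in> U \<Longrightarrow> wt n * norm (f s $ n) \<le> K" by (rule tame_bound[OF f]) blast
  \<comment> \<open>Half of the gap between \<open>S\<close> and \<open>r\<close> pays for the
    variation of the first coefficients near \<open>p\<close>, the other half for the tail, which
    \<open>K / wt n\<close> bounds uniformly in \<open>s\<close>.\<close>
  define e where "e = (r - S) / 2"
  have e: "e > 0" using Sr by (simp add: e_def)
  obtain N0 where N0: "norm (\<Sum>n. K / wt (n + N0)) < e"
    using suminf_exist_split[OF e summable_inverse_wt[of K]] by auto
  have "isCont (\<lambda>s. \<Sum>n\<le>N0. norm (f s $ n)) p" by (intro continuous_intros cont)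
  then have "\<forall>\<^sub>F s in nhds p. (\<Sum>n\<le>N0. norm (f s $ n)) < S + e"
    using S[of N0] e by (intro order_tendstoD(2)[of _ "\<Sum>n\<le>N0. norm (f p $ n)"]) (auto simp: isCont_def tendsto_nhds_iff)
  moreover have "\<forall>\<^sub>F s in nhds p. s \<in> U" using U by (rule eventually_nhds_in_open)
  ultimately have "\<forall>\<^sub>F s in nhds p. (\<Sum>n\<le>N0. norm (f s $ n)) < S + e \<and> s \<in> U" by (rule eventually_conj)
  then obtain d where d: "d > 0" "\<And>s. dist s p < d \<Longrightarrow> (\<Sum>n\<le>N0. norm (f s $ n)) < S + e \<and> s \<in> U"
    by (auto simp: eventually_nhds_metric)
  have "(\<Sum>n\<le>N. norm (f s $ n)) \<le> r" if s: "dist s p < d" for s N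
  proof -
    have sU: "s \<in> U" using d(2)[OF s] by blast
    have "(\<Sum>n\<le>N. norm (f s $ n)) \<le> (\<Sum>n\<in>{..<N0} \<union> {N0..N0+N}. norm (f s $ n))"
      by (rule sum_mono2) auto
    also have "\<dots> = (\<Sum>n<N0. norm (f s $ n)) + (\<Sum>n=N0..N0+N. norm (f s $ n))"
      by (rule sum.union_disjoint) auto
    also have "(\<Sum>n<N0. norm (f s $ n)) \<le> (\<Sum>n\<le>N0. norm (f s $ n))"
      by (rule sum_mono2) auto
    also have "\<dots> \<le> S + e" using d(2)[OF s] by simp
    also have "(\<Sum>n=N0..N0+N. norm (f s $ n)) = (\<Sum>n\<le>N. norm (f s $ (n + N0)))"
      by (rule sum.reindex_bij_witness[of _ "\<lambda>i. i + N0" "\<lambda>i. i - N0"]) auto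
    also have "\<dots> \<le> (\<Sum>n\<le>N. K / wt (n + N0))"
      using K(2)[OF sU] by (intro sum_mono) (simp add: field_simps)
    also have "\<dots> \<le> (\<Sum>n. K / wt (n + N0))"
      using K(1) summable_ignore_initial_segment[OF summable_inverse_wt[of K], of N0]
      by (intro sum_le_suminf) (auto simp: less_imp_le)
    also have "\<dots> \<le> e" using N0 by simp
    finally show ?thesis by (simp add: e_def field_simps)
  qed
  with d show ?thesis by (intro exI[of _ d]) (auto simp: dist_commute)
qed

text \<open>
  At the dominant singularity \<open>z = 1 / (1 + 2 \<surd>k)\<close>, the number \<open>\<surd>k\<close> is the solution of
  \<open>b = z (k + b + b\<^sup>2)\<close>, so it dominates all partial sums by induction.
\<close>

lemma term_gf_partial_l1:
  "(\<Sum>n\<le>N. norm (term_gf k L 0 $ n)) \<le> sqrt (real k)"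
proof (induction N arbitrary: L)
  case 0
  then show ?case by (simp add: term_gf_def)
next
  case (Suc N)
  define r where "r = sqrt (real k)"
  have r: "r \<ge> 0" "r ^ 2 = real k" by (auto simp: r_def)
  have l: "norm (lam k 0) = 1 + 2 * r" using r(1) by (simp only: lam_0 norm_of_real r_def[symmetric])
  let ?c = "fps_const (of_nat (min L k) * exp 0) :: complex fps"
  have le: "norm (term_gf k L 0 $ Suc n) \<le> 1 / (1 + 2 * r) * (norm (?c $ n) + norm (term_gf k (Suc L) 0 $ n)
      + (\<Sum>i\<le>n. norm (term_gf k L 0 $ i) * norm (term_gf k L 0 $ (n - i))))" for n
  proof -
    have "norm (term_gf k L 0 $ Suc n) = 1 / (1 + 2 * r) * norm (?c $ n + term_gf k (Suc L) 0 $ n + (term_gf k L 0 * term_gf k L 0) $ n)"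
      by (subst term_gf_nth_Suc) (simp_all add: lam_nonzero norm_mult norm_divide l del: exp_zero)
    also have "\<dots> \<le> 1 / (1 + 2 * r) * (norm (?c $ n) + norm (term_gf k (Suc L) 0 $ n) + norm ((term_gf k L 0 * term_gf k L 0) $ n))"
      using r by (intro mult_left_mono norm_triangle_le add_mono norm_triangle_ineq order_refl) simp_all
    also have "\<dots> \<le> 1 / (1 + 2 * r) * (norm (?c $ n) + norm (term_gf k (Suc L) 0 $ n)
      + (\<Sum>i\<le>n. norm (term_gf k L 0 $ i) * norm (term_gf k L 0 $ (n - i))))"
      using r by (intro mult_left_mono add_mono norm_fps_mult_nth_le order_refl) simp_all
    finally show ?thesis .
  qed
  have "(\<Sum>n\<le>N. norm (?c $ n)) = (\<Sum>n\<in>{0::nat}. real (min L k))"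
    by (rule sum.mono_neutral_cong_right) auto
  then have c: "(\<Sum>n\<le>N. norm (?c $ n)) \<le> real k" by simp
  have "(\<Sum>n\<le>Suc N. norm (term_gf k L 0 $ n)) = (\<Sum>n\<le>N. norm (term_gf k L 0 $ Suc n))"
    by (subst sum.atMost_Suc_shift) (simp add: term_gf_def)
  also have "\<dots> \<le> (\<Sum>n\<le>N. 1 / (1 + 2 * r) * (norm (?c $ n) + norm (term_gf k (Suc L) 0 $ n)
      + (\<Sum>i\<le>n. norm (term_gf k L 0 $ i) * norm (term_gf k L 0 $ (n - i)))))"
    by (rule sum_mono) (rule le)
  also have "\<dots> = 1 / (1 + 2 * r) * ((\<Sum>n\<le>N. norm (?c $ n)) + (\<Sum>n\<le>N. norm (term_gf k (Suc L) 0 $ n))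
      + (\<Sum>n\<le>N. \<Sum>i\<le>n. norm (term_gf k L 0 $ i) * norm (term_gf k L 0 $ (n - i))))"
    by (simp only: sum_distrib_left sum.distrib distrib_left)
  also have "\<dots> \<le> 1 / (1 + 2 * r) * (real k + r + (\<Sum>i\<le>N. norm (term_gf k L 0 $ i)) * (\<Sum>i\<le>N. norm (term_gf k L 0 $ i)))"
    using r Suc[of "Suc L"] c unfolding r_def[symmetric]
    by (intro mult_left_mono add_mono convolution_partial_sum_le) simp_all
  also have "\<dots> \<le> 1 / (1 + 2 * r) * (real k + r + r * r)"
    using r Suc[of L] unfolding r_def[symmetric]
    by (intro mult_left_mono add_mono mult_mono order_refl) (simp_all add: sum_nonneg)
  also have "\<dots> = r" using r by (simp add: field_simps power2_eq_square add_nonneg_eq_0_iff)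
  finally show ?case by (simp add: r_def)
qed

text \<open>The \<open>x\<close> for which \<open>level_gf_square\<close> reads
  \<open>(1 - level_gf k L s)^2 = 1 - x\<close>.\<close>

definition radicand :: "nat \<Rightarrow> nat \<Rightarrow> complex \<Rightarrow> complex fps" where
  "radicand k L s = 4 * scaled_X k s ^ 2 * (fps_const (of_nat L * exp s) + term_gf k (Suc L) s)"

lemma radicand_nth:
  "radicand k L s $ n = (if n < 2 then 0 else 4 / lam k s ^ 2 *
     (fps_const (of_nat L * exp s) $ (n - 2) + leaf_poly k (Suc L) (n - 2) s / lam k s ^ (n - 2)))"
proof -
  have "radicand k L s = fps_const (4 / lam k s ^ 2) * (fps_X ^ 2 * (fps_const (of_nat L * exp s) + term_gf k (Suc L) s))"
    by (simp add: radicand_def scaled_X_def power_mult_distrib fps_const_power power_divide mult_ac numeral_fps_const)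
  then show ?thesis by (simp add: fps_X_power_mult_nth term_gf_def)
qed

lemma isCont_radicand_nth: "isCont (\<lambda>s. radicand k L s $ n) 0"
proof -
  have lp: "isCont (\<lambda>s. leaf_poly k (Suc L) m s) 0" for m
    unfolding leaf_poly_def by (intro continuous_intros)
  have c: "isCont (\<lambda>s::complex. fps_const (of_nat L * exp s) $ m) 0" for m
  proof (cases m)
    case 0
    have "isCont (\<lambda>s::complex. of_nat L * exp s) 0" by (intro continuous_intros)
    then show ?thesis using 0 by simp
  qed simp
  show ?thesis
    unfolding radicand_nth
    by (cases "n < 2") (simp, simp only: if_False, intro continuous_intros isCont_lam lp c, simp_all add: lam_nonzero)
qed

text \<open>With \<open>r = sqrt k\<close>, the bound on \<open>term_gf\<close> gives
  \<open>S = 4 * (L + r) / (1 + 2 * r)^2\<close>. As \<open>L < r^2\<close>, the numerator is below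
  \<open>1 + 4 * r + 4 * r^2\<close>.\<close>

lemma radicand_partial_l1:
  assumes "L < k"
  obtains S where "S < 1" "\<And>N. (\<Sum>n\<le>N. norm (radicand k L 0 $ n)) \<le> S"
proof -
  define r where "r = sqrt (real k)"
  have r: "r > 0" "r ^ 2 = real k" using assms by (auto simp: r_def)
  have l: "norm (lam k 0) = 1 + 2 * r" using r(1) by (simp only: lam_0 norm_of_real r_def[symmetric])
  define S where "S = 4 / (1 + 2 * r) ^ 2 * (real L + r)"
  have "real L + 1 \<le> r ^ 2" using assms r(2) by simp
  then have "4 * (real L + r) < (1 + 2 * r) ^ 2" using r by (simp add: power2_eq_square algebra_simps)
  then have S: "S < 1" using r by (simp add: S_def divide_less_eq)
  have "(\<Sum>n\<le>N. norm (radicand k L 0 $ n)) \<le> S" for N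
  proof -
    let ?c = "fps_const (of_nat L * exp 0) :: complex fps"
    have "(\<Sum>n\<le>N. norm (?c $ n)) = (\<Sum>n\<in>{0::nat}. real L)"
      by (rule sum.mono_neutral_cong_right) auto
    then have c: "(\<Sum>n\<le>N. norm (?c $ n)) \<le> real L" by simp
    have "(\<Sum>n\<le>N. norm (radicand k L 0 $ n)) \<le> (\<Sum>n\<le>N + 2. norm (radicand k L 0 $ n))"
      by (rule sum_mono2) auto
    also have "\<dots> = (\<Sum>n\<le>N. norm (radicand k L 0 $ (n + 2)))"
    proof -
      have "radicand k L 0 $ 0 = 0" "radicand k L 0 $ Suc 0 = 0" by (simp_all add: radicand_nth)
      then show ?thesis by (simp add: sum.atMost_Suc_shift numeral_2_eq_2 del: sum.atMost_Suc)
    qed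
    also have "\<dots> \<le> (\<Sum>n\<le>N. 4 / (1 + 2 * r) ^ 2 * (norm (?c $ n) + norm (term_gf k (Suc L) 0 $ n)))"
    proof (rule sum_mono)
      fix n
      have "norm (radicand k L 0 $ (n + 2)) = 4 / (1 + 2 * r) ^ 2 * norm (?c $ n + term_gf k (Suc L) 0 $ n)"
        by (simp add: radicand_nth term_gf_def norm_mult norm_divide norm_power l del: exp_zero)
      also have "\<dots> \<le> 4 / (1 + 2 * r) ^ 2 * (norm (?c $ n) + norm (term_gf k (Suc L) 0 $ n))"
        by (intro mult_left_mono norm_triangle_ineq) simp
      finally show "norm (radicand k L 0 $ (n + 2)) \<le> \<dots>" .
    qed
    also have "\<dots> = 4 / (1 + 2 * r) ^ 2 * ((\<Sum>n\<le>N. norm (?c $ n)) + (\<Sum>n\<le>N. norm (term_gf k (Suc L) 0 $ n)))"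
      by (simp only: sum_distrib_left sum.distrib distrib_left)
    also have "\<dots> \<le> S" unfolding S_def
      using c term_gf_partial_l1[of k "Suc L" N] by (intro mult_left_mono add_mono) (simp_all add: r_def)
    finally show ?thesis .
  qed
  with S show ?thesis by (rule that)
qed

text \<open>The radicand is \<open>2 * z\<close> times \<open>level_gf\<close> of the next level
  plus \<open>4 * L * exp s * z^2\<close>, so tameness passes to it without division by
  \<open>z\<close>.\<close>

lemma tame_radicand:
  assumes t: "tame U (level_gf k (Suc L)) \<xi>" and U: "U \<subseteq> ball 0 1"
  shows "\<exists>\<eta>. tame U (radicand k L) \<eta>"
proof -
  have X: "tame U (scaled_X k) (\<lambda>s. 0)" by (rule tame_subset[OF tame_scaled_X U])
  \<comment> \<open>The minus sign turns the sum into a difference, the form that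
    \<open>tame_diff\<close> handles.\<close>
  have c: "tame U (\<lambda>s. fps_const (- 4 * (of_nat L * exp s))) (\<lambda>s. 0)"
  proof (rule tame_const)
    fix s assume "s \<in> U"
    then have "norm s \<le> 1" using U by auto
    then have "norm (exp s) \<le> exp 1" using norm_exp[of s] by (meson exp_le_cancel_iff order_trans)
    then show "norm (- 4 * (of_nat L * exp s)) \<le> 4 * (real L * exp 1)"
      by (simp add: norm_mult mult_left_mono)
  qed
  have two: "tame U (\<lambda>s. fps_const 2) (\<lambda>s. 0)" by (rule tame_const[where K = 2]) simp
  note XX = tame_mult[OF X X] and Xt = tame_mult[OF X t]
  note T = tame_diff[OF tame_mult[OF two Xt] tame_mult[OF c XX]]
  then obtain \<eta> where \<eta>: "tame U (\<lambda>s. fps_const 2 * (scaled_X k s * level_gf k (Suc L) s)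
      - fps_const (- 4 * (of_nat L * exp s)) * (scaled_X k s * scaled_X k s)) \<eta>"
    by blast
  have "tame U (radicand k L) \<eta>"
  proof (rule tame_cong[OF \<eta>])
    fix s assume "s \<in> U"
    have c4: "fps_const (- 4 * (of_nat L * exp s)) = - (fps_const 4 * fps_const (of_nat L * exp s))"
      by simp
    have c: "fps_const 2 = (2 :: complex fps)" "fps_const 4 = (4 :: complex fps)"
      by (simp_all add: numeral_fps_const)
    show "fps_const 2 * (scaled_X k s * level_gf k (Suc L) s)
      - fps_const (- 4 * (of_nat L * exp s)) * (scaled_X k s * scaled_X k s) = radicand k L s"
      unfolding radicand_def level_gf_def c4 c by algebra
  qed
  then show ?thesis by blast
qed

lemma level_gf_eq_compose:
  assumes "s \<in> ball 0 1" "L \<le> k"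
  shows "level_gf k L s = fps_const 1 - (sqrt_fps 1 oo radicand k L s)"
proof -
  have r0: "radicand k L s $ 0 = 0" by (simp add: radicand_nth)
  have "1 - level_gf k L s = sqrt_fps 1 oo radicand k L s"
  proof (rule fps_square_eq_imp_eq)
    show "(1 - level_gf k L s)\<^sup>2 = (sqrt_fps 1 oo radicand k L s)\<^sup>2"
      unfolding sqrt_fps_compose_square[OF r0] using level_gf_square[OF lam_nonzero[OF assms(1)] assms(2)]
      by (simp add: radicand_def)
  qed simp_all
  then show ?thesis by (simp add: algebra_simps)
qed

lemma leaf_poly_at_0: "leaf_poly k L n 0 = of_nat (card (terms_under k L n))"
  by (simp add: leaf_poly_def)

lemma card_terms_under_mono: "card (terms_under k (Suc L) n) \<le> card (terms_under k L (Suc n))"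
proof -
  have "card (terms_under k (Suc L) n) = card (LAbs ` terms_under k (Suc L) n)"
    by (rule card_image[symmetric]) (auto simp: inj_on_def)
  also have "\<dots> \<le> card (terms_under k L (Suc n))"
    by (rule card_mono[OF finite_terms_under]) (auto simp: terms_under_Suc)
  finally show ?thesis .
qed

lemma level_gf_nth_at_0:
  "level_gf k L 0 $ Suc n = of_real (2 * real (card (terms_under k L n)) / (1 + 2 * sqrt (real k)) ^ Suc n)"
  by (simp add: level_gf_nth leaf_poly_at_0 lam_0)

lemma tame_tendsto: "tame U f \<xi> \<Longrightarrow> s \<in> U \<Longrightarrow> (\<lambda>n. of_real (wt n) * f s $ n) \<longlonglongrightarrow> \<xi> s"
  unfolding tame_def by (auto intro: tendsto_uniform_limitI)

text \<open>
  Keeps the limit constant from vanishing on the way down: prefixing an abstraction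
  injects the terms of level \<open>L + 1\<close> into those of level \<open>L\<close>.
\<close>

lemma level_gf_limit_mono:
  assumes "tame U (level_gf k L) \<xi>" "tame V (level_gf k (Suc L)) \<eta>" "0 \<in> U" "0 \<in> V"
  shows "Re (\<eta> 0) / (1 + 2 * sqrt (real k)) \<le> Re (\<xi> 0)"
proof -
  define l where "l = 1 + 2 * sqrt (real k)"
  have l: "l > 0" by (simp add: l_def add_pos_nonneg)
  \<comment> \<open>The factor \<open>z\<close> in \<open>level_gf\<close> shifts sizes by one and
    the added abstraction by one more: coefficient \<open>Suc (Suc n)\<close> at level
    \<open>L\<close> is compared with \<open>Suc n\<close> at level \<open>Suc L\<close>, and
    dividing by \<open>l\<close> equalises the powers of \<open>l\<close>.\<close>
  have 1: "(\<lambda>n. Re (of_real (wt (Suc (Suc n))) * level_gf k L 0 $ Suc (Suc n))) \<longlonglongrightarrow> Re (\<xi> 0)"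
    using LIMSEQ_Suc[OF LIMSEQ_Suc[OF tame_tendsto[OF assms(1,3)]]] by (rule tendsto_Re)
  have 2: "(\<lambda>n. Re (of_real (wt (Suc n)) * level_gf k (Suc L) 0 $ Suc n) / l) \<longlonglongrightarrow> Re (\<eta> 0) / l"
    using LIMSEQ_Suc[OF tame_tendsto[OF assms(2,4)]] l by (intro tendsto_intros) auto
  have "Re (of_real (wt (Suc n)) * level_gf k (Suc L) 0 $ Suc n) / l \<le> Re (of_real (wt (Suc (Suc n))) * level_gf k L 0 $ Suc (Suc n))" for n
  proof -
    have "wt (Suc n) \<le> wt (Suc (Suc n))" unfolding wt_def by (intro powr_mono2) auto
    then have "wt (Suc n) * (2 * real (card (terms_under k (Suc L) n)) / l ^ Suc (Suc n))
        \<le> wt (Suc (Suc n)) * (2 * real (card (terms_under k L (Suc n))) / l ^ Suc (Suc n))"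
      using l card_terms_under_mono[of k L n] by (intro mult_mono divide_right_mono) auto
    moreover have "Re (of_real (wt (Suc n)) * level_gf k (Suc L) 0 $ Suc n) / l = wt (Suc n) * (2 * real (card (terms_under k (Suc L) n)) / l ^ Suc (Suc n))"
      unfolding level_gf_nth_at_0 l_def[symmetric] of_real_mult[symmetric] Re_complex_of_real by simp
    moreover have "Re (of_real (wt (Suc (Suc n))) * level_gf k L 0 $ Suc (Suc n)) = wt (Suc (Suc n)) * (2 * real (card (terms_under k L (Suc n))) / l ^ Suc (Suc n))"
      unfolding level_gf_nth_at_0 l_def[symmetric] of_real_mult[symmetric] Re_complex_of_real by simp
    ultimately show ?thesis by simp
  qed
  then show ?thesis unfolding l_def[symmetric] by (intro LIMSEQ_le[OF 2 1]) blast
qed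

text \<open>Near 0 the radicand keeps its norm sum below some \<open>r < 1\<close>, so
  \<open>tame_compose\<close> applies to the square root, on a possibly smaller disc. Positivity of
  the constant comes from \<open>level_gf_limit_mono\<close>.\<close>

lemma tame_level_gf_step:
  assumes L: "L < k" and d: "0 < \<delta>" "\<delta> \<le> 1" and t: "tame (ball 0 \<delta>) (level_gf k (Suc L)) \<xi>" and pos: "Re (\<xi> 0) > 0"
  shows "\<exists>\<delta>' \<xi>'. 0 < \<delta>' \<and> \<delta>' \<le> 1 \<and> tame (ball 0 \<delta>') (level_gf k L) \<xi>' \<and> Re (\<xi>' 0) > 0"
proof -
  have U: "ball 0 \<delta> \<subseteq> ball (0::complex) 1" using d by auto
  obtain \<eta> where \<eta>: "tame (ball 0 \<delta>) (radicand k L) \<eta>" using tame_radicand[OF t U] ..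
  obtain S where S: "S < 1" "\<And>N. (\<Sum>n\<le>N. norm (radicand k L 0 $ n)) \<le> S" by (rule radicand_partial_l1[OF L]) blast
  obtain r where r: "S < r" "r < 1" using dense[OF S(1)] by blast
  have "\<exists>\<delta>'>0. ball (0::complex) \<delta>' \<subseteq> ball 0 \<delta> \<and> (\<forall>s\<in>ball 0 \<delta>'. \<forall>N. (\<Sum>n\<le>N. norm (radicand k L s $ n)) \<le> r)"
    by (rule uniform_partial_l1_near[of "ball 0 \<delta>" "radicand k L" \<eta> 0 S r, OF \<eta>]) (use d S r isCont_radicand_nth in auto)
  then obtain \<delta>1 where d1: "\<delta>1 > 0" "ball 0 \<delta>1 \<subseteq> ball (0::complex) \<delta>"
    "\<And>s N. s \<in> ball 0 \<delta>1 \<Longrightarrow> (\<Sum>n\<le>N. norm (radicand k L s $ n)) \<le> r" by blast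
  define \<delta>' where "\<delta>' = min \<delta>1 1"
  have d': "\<delta>' > 0" "\<delta>' \<le> 1" "ball 0 \<delta>' \<subseteq> ball (0::complex) \<delta>1" "ball 0 \<delta>' \<subseteq> ball (0::complex) 1"
    using d1 by (auto simp: \<delta>'_def)
  have t': "tame (ball 0 \<delta>') (radicand k L) \<eta>" by (rule tame_subset[OF \<eta>]) (use d'(3) d1(2) in blast)
  have "\<exists>\<zeta>. tame (ball 0 \<delta>') (\<lambda>s. sqrt_fps 1 oo radicand k L s) \<zeta>"
    by (rule tame_compose[OF t' norm_sqrt_fps_1_le _ r(2) d1(3)]) (use d'(3) in \<open>auto simp: radicand_nth\<close>)
  then obtain \<zeta> where \<zeta>: "tame (ball 0 \<delta>') (\<lambda>s. sqrt_fps 1 oo radicand k L s) \<zeta>" ..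
  have c: "tame (ball (0::complex) \<delta>') (\<lambda>s. fps_const 1) (\<lambda>s. 0)" by (rule tame_const[of _ _ 1]) auto
  have T: "tame (ball 0 \<delta>') (level_gf k L) (\<lambda>s. 0 - \<zeta> s)"
    by (rule tame_cong[OF tame_diff[OF c \<zeta>]]) (use d'(4) L in \<open>auto simp: level_gf_eq_compose\<close>)
  have "Re (\<xi> 0) / (1 + 2 * sqrt (real k)) \<le> Re (0 - \<zeta> 0)"
    by (rule level_gf_limit_mono[OF T t]) (use d' d in auto)
  moreover have "Re (\<xi> 0) / (1 + 2 * sqrt (real k)) > 0" using pos by (simp add: add_pos_nonneg)
  ultimately have "Re (0 - \<zeta> 0) > 0" by linarith
  then show ?thesis using T d' by blast
qed

text \<open>Downward induction over the levels, written as \<open>k - j\<close>. Positivity is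
  carried along instead of mere non-vanishing, since neighbouring levels are compared by an
  inequality.\<close>

lemma tame_level_gf_0:
  assumes k: "k \<ge> 1"
  shows "\<exists>\<delta> \<xi>. 0 < \<delta> \<and> \<delta> \<le> 1 \<and> tame (ball 0 \<delta>) (level_gf k 0) \<xi> \<and> Re (\<xi> 0) > 0"
proof -
  have "\<exists>\<delta> \<xi>. 0 < \<delta> \<and> \<delta> \<le> 1 \<and> tame (ball 0 \<delta>) (level_gf k (k - j)) \<xi> \<and> Re (\<xi> 0) > 0" if "j \<le> k" for j
    using that
  proof (induction j)
    case 0
    obtain \<delta> \<xi> where d: "0 < \<delta>" "\<delta> \<le> 1" and t: "tame (ball 0 \<delta>) (level_gf k k) \<xi>" and nz: "\<xi> 0 \<noteq> 0"
      using tame_level_gf_top[OF k] by blast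
    have lim: "(\<lambda>n. of_real (wt (Suc n)) * level_gf k k 0 $ Suc n) \<longlonglongrightarrow> \<xi> 0"
      using LIMSEQ_Suc[OF tame_tendsto[OF t]] d by auto
    define a where "a n = wt (Suc n) * (2 * real (card (terms_under k k n)) / (1 + 2 * sqrt (real k)) ^ Suc n)" for n
    have a: "of_real (wt (Suc n)) * level_gf k k 0 $ Suc n = of_real (a n)" for n
      by (simp only: level_gf_nth_at_0 a_def of_real_mult)
    have a0: "a n \<ge> 0" for n by (simp add: a_def)
    \<comment> \<open>At \<open>s = 0\<close> the coefficients come from cardinalities, so the
      non-zero limit is a positive real.\<close>
    have "(\<lambda>n. Re (of_real (a n))) \<longlonglongrightarrow> Re (\<xi> 0)" "(\<lambda>n. Im (of_real (a n))) \<longlonglongrightarrow> Im (\<xi> 0)"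
      using lim unfolding a by (rule tendsto_Re, rule tendsto_Im)
    then have "Re (\<xi> 0) \<ge> 0" "Im (\<xi> 0) = 0"
      using a0 by (auto intro: LIMSEQ_le_const simp: LIMSEQ_const_iff)
    then have "Re (\<xi> 0) > 0" using nz by (simp add: complex_eq_iff)
    then show ?case using d t by auto
  next
    case (Suc j)
    then have "Suc (k - Suc j) = k - j" "k - Suc j < k" by auto
    then show ?case using Suc tame_level_gf_step[of "k - Suc j" k] by (metis Suc_leD)
  qed
  from this[of k] show ?thesis by simp
qed

section \<open>Quasi-powers\<close>

text \<open>Both sides are differentiated twice at 0; finite support makes the transform a finite
  sum of exponentials. In the variance the square of \<open>\<nu> * deriv \<psi> 0\<close> and its
  cross terms with \<open>deriv E 0\<close> cancel, which leaves an expression linear in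
  \<open>\<nu>\<close>.\<close>

lemma exponential_moments:
  fixes p :: "'a pmf" and X :: "'a \<Rightarrow> real" and \<psi> E :: "complex \<Rightarrow> complex" and \<nu> :: complex
  defines "P \<equiv> \<lambda>s. measure_pmf.expectation p (\<lambda>a. exp (s * of_real (X a)))"
  assumes fin: "finite (set_pmf p)" and \<delta>: "\<delta> > 0"
    and \<psi>: "\<psi> holomorphic_on ball 0 \<delta>" "\<psi> 0 = 0" and E: "E holomorphic_on ball 0 \<delta>"
    and P: "\<And>s. s \<in> ball 0 \<delta> \<Longrightarrow> P s = exp (\<nu> * \<psi> s) * E s"
  shows "E 0 = 1"
    and "of_real (measure_pmf.expectation p X) = \<nu> * deriv \<psi> 0 + deriv E 0"
    and "of_real (measure_pmf.variance p X) = \<nu> * deriv (deriv \<psi>) 0 + deriv (deriv E) 0 - deriv E 0 ^ 2"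
proof -
  let ?S = "set_pmf p" and ?B = "ball (0::complex) \<delta>"
  have ex: "measure_pmf.expectation p f = (\<Sum>a\<in>?S. pmf p a *\<^sub>R f a)" for f :: "'a \<Rightarrow> 'b::{banach,second_countable_topology}"
    by (rule integral_measure_pmf[OF fin]) auto
  define P1 where "P1 s = (\<Sum>a\<in>?S. of_real (pmf p a * X a) * exp (s * of_real (X a)))" for s :: complex
  define P2 where "P2 s = (\<Sum>a\<in>?S. of_real (pmf p a * X a ^ 2) * exp (s * of_real (X a)))" for s :: complex
  have P_eq: "P = (\<lambda>s. \<Sum>a\<in>?S. of_real (pmf p a) * exp (s * of_real (X a)))"
    unfolding P_def ex by (simp add: scaleR_conv_of_real)
  have dP: "(P has_field_derivative P1 s) (at s)" for s
    unfolding P_eq P1_def by (auto intro!: derivative_eq_intros sum.cong)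
  have dP1: "(P1 has_field_derivative P2 s) (at s)" for s
    unfolding P1_def P2_def by (auto intro!: derivative_eq_intros sum.cong simp: power2_eq_square)
  have d\<psi>: "(\<psi> has_field_derivative deriv \<psi> s) (at s)" "(deriv \<psi> has_field_derivative deriv (deriv \<psi>) s) (at s)"
    and dE: "(E has_field_derivative deriv E s) (at s)" "(deriv E has_field_derivative deriv (deriv E) s) (at s)"
    if "s \<in> ?B" for s
    using that \<psi> E by (auto intro!: holomorphic_derivI[of _ ?B] holomorphic_deriv)
  define F1 where "F1 s = exp (\<nu> * \<psi> s) * (\<nu> * deriv \<psi> s * E s + deriv E s)" for s
  have 0: "0 \<in> ?B" using \<delta> by simp
  have P1: "P1 s = F1 s" if s: "s \<in> ?B" for s
  proof (rule DERIV_unique[OF dP])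
    have "((\<lambda>s. exp (\<nu> * \<psi> s) * E s) has_field_derivative F1 s) (at s)"
      unfolding F1_def using s
      by (auto intro!: derivative_eq_intros d\<psi> dE simp: algebra_simps)
    then show "(P has_field_derivative F1 s) (at s)"
      by (rule has_field_derivative_transform_within_open[of _ _ _ ?B]) (use s P in auto)
  qed
  have P2: "P2 0 = exp (\<nu> * \<psi> 0) * (\<nu> * deriv \<psi> 0 * (\<nu> * deriv \<psi> 0 * E 0 + deriv E 0)
      + \<nu> * deriv (deriv \<psi>) 0 * E 0 + \<nu> * deriv \<psi> 0 * deriv E 0 + deriv (deriv E) 0)"
  proof (rule DERIV_unique[OF dP1])
    have "(F1 has_field_derivative exp (\<nu> * \<psi> 0) * (\<nu> * deriv \<psi> 0 * (\<nu> * deriv \<psi> 0 * E 0 + deriv E 0)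
      + \<nu> * deriv (deriv \<psi>) 0 * E 0 + \<nu> * deriv \<psi> 0 * deriv E 0 + deriv (deriv E) 0)) (at 0)"
      unfolding F1_def using 0
      by (auto intro!: derivative_eq_intros d\<psi> dE simp: algebra_simps)
    then show "(P1 has_field_derivative exp (\<nu> * \<psi> 0) * (\<nu> * deriv \<psi> 0 * (\<nu> * deriv \<psi> 0 * E 0 + deriv E 0)
      + \<nu> * deriv (deriv \<psi>) 0 * E 0 + \<nu> * deriv \<psi> 0 * deriv E 0 + deriv (deriv E) 0)) (at 0)"
      by (rule has_field_derivative_transform_within_open[of _ _ _ ?B]) (use 0 P1 in auto)
  qed
  have "P 0 = 1" by (simp add: P_def)
  then show E0: "E 0 = 1" using P[OF 0] \<psi> by simp
  have \<mu>: "of_real (measure_pmf.expectation p X) = P1 0" by (simp add: ex P1_def)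
  then show \<mu>': "of_real (measure_pmf.expectation p X) = \<nu> * deriv \<psi> 0 + deriv E 0"
    using P1[OF 0] E0 \<psi> by (simp add: F1_def)
  have "measure_pmf.variance p X = measure_pmf.expectation p (\<lambda>a. X a ^ 2) - (measure_pmf.expectation p X) ^ 2"
    using fin by (intro measure_pmf.variance_eq integrable_measure_pmf_finite)
  moreover have "of_real (measure_pmf.expectation p (\<lambda>a. X a ^ 2)) = P2 0" by (simp add: ex P2_def)
  ultimately have "of_real (measure_pmf.variance p X) = P2 0 - (\<nu> * deriv \<psi> 0 + deriv E 0) ^ 2"
    by (simp add: \<mu>')
  then show "of_real (measure_pmf.variance p X) = \<nu> * deriv (deriv \<psi>) 0 + deriv (deriv E) 0 - deriv E 0 ^ 2"
    using P2 E0 \<psi> by (simp add: algebra_simps power2_eq_square)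
qed

text \<open>The third derivative is bounded on the closed disc of radius \<open>\<delta>/2\<close>,
  so the quotient is of order \<open>norm s\<close>.\<close>

lemma taylor_quadratic_remainder:
  fixes \<psi> :: "complex \<Rightarrow> complex"
  assumes \<delta>: "\<delta> > 0" and \<psi>: "\<psi> holomorphic_on ball 0 \<delta>" "\<psi> 0 = 0"
  shows "((\<lambda>s. (\<psi> s - deriv \<psi> 0 * s - deriv (deriv \<psi>) 0 / 2 * s ^ 2) / s ^ 2) \<longlongrightarrow> 0) (at 0)"
proof -
  let ?S = "cball (0::complex) (\<delta>/2)"
  have sub: "?S \<subseteq> ball 0 \<delta>" using \<delta> by auto
  have hol: "(deriv ^^ i) \<psi> holomorphic_on ball 0 \<delta>" for i
    using \<psi> by (intro holomorphic_higher_deriv) auto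
  have "continuous_on ?S ((deriv ^^ 3) \<psi>)"
    using hol sub by (meson holomorphic_on_imp_continuous_on continuous_on_subset)
  then have "compact ((deriv ^^ 3) \<psi> ` ?S)" by (intro compact_continuous_image) auto
  then obtain B where B: "\<And>x. x \<in> ?S \<Longrightarrow> norm ((deriv ^^ 3) \<psi> x) \<le> B"
    using compact_imp_bounded by (force simp: bounded_iff)
  have bound: "norm ((\<psi> s - deriv \<psi> 0 * s - deriv (deriv \<psi>) 0 / 2 * s ^ 2) / s ^ 2) \<le> B / 2 * norm s" if s: "s \<in> ?S" for s
  proof (cases "s = 0")
    case False
    have "norm ((deriv ^^ 0) \<psi> s - (\<Sum>i\<le>2. (deriv ^^ i) \<psi> 0 * (s - 0) ^ i / fact i)) \<le> B * norm (s - 0) ^ Suc 2 / fact 2"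
    proof (rule complex_Taylor[of ?S])
      fix i x assume "x \<in> ?S"
      then have "x \<in> ball 0 \<delta>" using sub by blast
      then have "((deriv ^^ i) \<psi> has_field_derivative deriv ((deriv ^^ i) \<psi>) x) (at x)"
        using hol by (intro holomorphic_derivI) auto
      then show "((deriv ^^ i) \<psi> has_field_derivative (deriv ^^ Suc i) \<psi> x) (at x within ?S)"
        by (simp add: has_field_derivative_at_within)
    next
      fix x assume "x \<in> ?S"
      then show "norm ((deriv ^^ Suc 2) \<psi> x) \<le> B" using B by (simp add: numeral_3_eq_3 numeral_2_eq_2)
    qed (use s \<delta> in auto)
    moreover have "(deriv ^^ 0) \<psi> s - (\<Sum>i\<le>2. (deriv ^^ i) \<psi> 0 * (s - 0) ^ i / fact i) = \<psi> s - deriv \<psi> 0 * s - deriv (deriv \<psi>) 0 / 2 * s ^ 2"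
      using \<psi> by (simp add: numeral_2_eq_2)
    ultimately have "norm (\<psi> s - deriv \<psi> 0 * s - deriv (deriv \<psi>) 0 / 2 * s ^ 2) \<le> B / 2 * norm s * norm s ^ 2"
      by (simp add: power3_eq_cube power2_eq_square field_simps)
    then show ?thesis using False by (simp only: norm_divide norm_power) (simp add: divide_le_eq)
  qed simp
  have "\<forall>\<^sub>F s in at (0::complex). s \<in> ?S"
    using \<delta> by (auto simp: eventually_at dist_commute intro!: exI[of _ "\<delta>/2"])
  then have "\<forall>\<^sub>F s in at 0. norm ((\<psi> s - deriv \<psi> 0 * s - deriv (deriv \<psi>) 0 / 2 * s ^ 2) / s ^ 2) \<le> B / 2 * norm s"
    by (rule eventually_mono) (rule bound)
  moreover have "((\<lambda>s::complex. B / 2 * norm s) \<longlongrightarrow> 0) (at 0)"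
    by (auto intro!: tendsto_eq_intros)
  ultimately show ?thesis by (rule Lim_null_comparison)
qed

text \<open>Uniform convergence on a disc carries over to the derivatives at 0, so
  \<open>\<mu> n - m * real n\<close> and \<open>V n - v * real n\<close> converge. For the limit
  law the transform is evaluated at \<open>\<i> * t / sqrt (V n)\<close>, which tends to 0, and
  Levy's continuity theorem concludes.\<close>

theorem quasi_power:
  fixes p :: "nat \<Rightarrow> 'a pmf" and X :: "'a \<Rightarrow> real" and \<psi> E' :: "complex \<Rightarrow> complex" and E :: "nat \<Rightarrow> complex \<Rightarrow> complex"
  defines "\<mu> \<equiv> \<lambda>n. measure_pmf.expectation (p n) X" and "V \<equiv> \<lambda>n. measure_pmf.variance (p n) X"
  assumes fin: "\<forall>\<^sub>F n in sequentially. finite (set_pmf (p n))" and \<delta>: "\<delta> > 0"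
    and \<psi>: "\<psi> holomorphic_on ball 0 \<delta>" "\<psi> 0 = 0"
    and E: "\<forall>\<^sub>F n in sequentially. E n holomorphic_on ball 0 \<delta>"
    and lim: "uniform_limit (ball 0 \<delta>) E E' sequentially"
    and P: "\<forall>\<^sub>F n in sequentially. \<forall>s\<in>ball 0 \<delta>.
       measure_pmf.expectation (p n) (\<lambda>a. exp (s * of_real (X a))) = exp (of_nat n * \<psi> s) * E n s"
    and m: "deriv \<psi> 0 = of_real m" "m > 0" and v: "deriv (deriv \<psi>) 0 = of_real v" "v > 0"
  shows "\<mu> \<sim>[at_top] (\<lambda>n. m * real n)"
    and "V \<sim>[at_top] (\<lambda>n. v * real n)"
    and "weak_conv_m (\<lambda>n. distr (measure_pmf (p n)) borel (\<lambda>a. (X a - \<mu> n) / sqrt (V n))) std_normal_distribution"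
proof -
  have 0: "0 \<in> ball (0::complex) \<delta>" using \<delta> by simp
  have ev: "\<forall>\<^sub>F n in sequentially. E n 0 = 1 \<and> of_real (\<mu> n) = of_nat n * of_real m + deriv (E n) 0 \<and>
     of_real (V n) = of_nat n * of_real v + deriv (deriv (E n)) 0 - deriv (E n) 0 ^ 2"
    using fin E P
  proof eventually_elim
    case (elim n)
    show ?case unfolding \<mu>_def V_def m(1)[symmetric] v(1)[symmetric]
      using exponential_moments[OF elim(1) \<delta> \<psi> elim(2), of X "of_nat n"] elim(3) by blast
  qed
  have d: "(\<lambda>n. (deriv ^^ j) (E n) 0) \<longlonglongrightarrow> (deriv ^^ j) E' 0" for j
    by (rule higher_deriv_complex_uniform_limit[OF lim E]) (use \<delta> in auto)
  have d1: "(\<lambda>n. deriv (E n) 0) \<longlonglongrightarrow> deriv E' 0" using d[of 1] by simp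
  have d2: "(\<lambda>n. deriv (deriv (E n)) 0) \<longlonglongrightarrow> deriv (deriv E') 0" using d[of 2] by (simp add: numeral_2_eq_2)
  have mean: "(\<lambda>n. \<mu> n - m * real n) \<longlonglongrightarrow> Re (deriv E' 0)"
  proof (rule Lim_transform_eventually[OF tendsto_Re[OF d1]])
    show "\<forall>\<^sub>F n in sequentially. Re (deriv (E n) 0) = \<mu> n - m * real n"
      using ev
    proof eventually_elim
      case (elim n)
      then have "Re (of_real (\<mu> n)) = Re (of_nat n * of_real m + deriv (E n) 0)" by simp
      then show ?case by simp
    qed
  qed
  have var: "(\<lambda>n. V n - v * real n) \<longlonglongrightarrow> Re (deriv (deriv E') 0 - deriv E' 0 ^ 2)"
  proof (rule Lim_transform_eventually[OF tendsto_Re[OF tendsto_diff[OF d2 tendsto_power[OF d1]]]])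
    show "\<forall>\<^sub>F n in sequentially. Re (deriv (deriv (E n)) 0 - deriv (E n) 0 ^ 2) = V n - v * real n"
      using ev
    proof eventually_elim
      case (elim n)
      then have "Re (of_real (V n)) = Re (of_nat n * of_real v + (deriv (deriv (E n)) 0 - deriv (E n) 0 ^ 2))" by simp
      then show ?case by simp
    qed
  qed
  have ratio: "(\<lambda>n. f n / (c * real n)) \<longlonglongrightarrow> 1" if "(\<lambda>n. f n - c * real n) \<longlonglongrightarrow> l" "c > 0" for f c l
  proof -
    have "(\<lambda>n. (f n - c * real n) * (1 / (c * real n)) + 1) \<longlonglongrightarrow> l * 0 + 1"
      using that(2) by (intro tendsto_intros that(1)) real_asymp
    moreover have "\<forall>\<^sub>F n in sequentially. (f n - c * real n) * (1 / (c * real n)) + 1 = f n / (c * real n)"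
      using eventually_gt_at_top[of 0]
      by eventually_elim (use that(2) in \<open>simp add: field_simps\<close>)
    ultimately show ?thesis using Lim_transform_eventually by fastforce
  qed
  show "\<mu> \<sim>[at_top] (\<lambda>n. m * real n)" by (rule asymp_equivI') (rule ratio[OF mean m(2)])
  show Vas: "V \<sim>[at_top] (\<lambda>n. v * real n)" by (rule asymp_equivI') (rule ratio[OF var v(2)])
  have Vr: "(\<lambda>n. V n / (v * real n)) \<longlonglongrightarrow> 1" by (rule ratio[OF var v(2)])
  have "filterlim (\<lambda>n. v * real n) at_top sequentially" using v(2) by real_asymp
  then have Vtop: "filterlim V at_top sequentially"
    using asymp_equiv_at_top_transfer[OF asymp_equiv_symI[OF Vas]] by blast
  have Vpos: "\<forall>\<^sub>F n in sequentially. V n > 0"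
    using Vtop by (simp add: filterlim_at_top_dense)
  show "weak_conv_m (\<lambda>n. distr (measure_pmf (p n)) borel (\<lambda>a. (X a - \<mu> n) / sqrt (V n))) std_normal_distribution"
  proof (rule levy_continuity)
    show "real_distribution (distr (measure_pmf (p n)) borel (\<lambda>a. (X a - \<mu> n) / sqrt (V n)))" for n
      by (rule prob_space.real_distribution_distr[OF prob_space_measure_pmf]) simp
    show "real_distribution std_normal_distribution" by (rule real_dist_normal_dist)
    fix t :: real
    define s where "s n = \<i> * complex_of_real (t / sqrt (V n))" for n
    have s_lim: "s \<longlonglongrightarrow> 0"
    proof -
      have "filterlim (\<lambda>n. sqrt (V n)) at_infinity sequentially"
        by (intro filterlim_at_top_imp_at_infinity filterlim_compose[OF sqrt_at_top Vtop])
      then have "(\<lambda>n. t / sqrt (V n)) \<longlonglongrightarrow> 0" by (rule tendsto_divide_0[OF tendsto_const])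
      from tendsto_mult[OF tendsto_const[of \<i>] tendsto_of_real[OF this, where 'a = complex]]
      show ?thesis by (simp add: s_def[abs_def])
    qed
    have s_ball: "\<forall>\<^sub>F n in sequentially. s n \<in> ball 0 \<delta>"
      by (rule topological_tendstoD[OF s_lim]) (use \<delta> in auto)
    have E_lim: "(\<lambda>n. E n (s n)) \<longlonglongrightarrow> 1"
    proof -
      have "continuous_on (ball 0 \<delta>) E'"
        by (rule uniform_limit_theorem[OF _ lim]) (use E in \<open>auto elim: eventually_mono intro: holomorphic_on_imp_continuous_on\<close>)
      then have "isCont E' 0" using 0 by (simp add: continuous_on_eq_continuous_at)
      then have c: "(\<lambda>n. E' (s n)) \<longlonglongrightarrow> E' 0" by (rule isCont_tendsto_compose[OF _ s_lim])
      have "(\<lambda>n. E n (s n) - E' (s n)) \<longlonglongrightarrow> 0"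
      proof (rule tendstoI)
        fix e :: real assume "e > 0"
        from uniform_limitD[OF lim this] s_ball
        show "\<forall>\<^sub>F n in sequentially. dist (E n (s n) - E' (s n)) 0 < e"
          by eventually_elim (simp add: dist_norm)
      qed
      from tendsto_add[OF this c] have "(\<lambda>n. E n (s n)) \<longlonglongrightarrow> E' 0" by simp
      moreover have "(\<lambda>n. E n 0) \<longlonglongrightarrow> E' 0" using d[of 0] by simp
      moreover have "(\<lambda>n. E n 0) \<longlonglongrightarrow> 1"
        by (rule tendsto_eventually) (use ev in \<open>auto elim: eventually_mono\<close>)
      ultimately show ?thesis using LIMSEQ_unique by metis
    qed
    \<comment> \<open>Division by zero gives \<open>R 0 = 0\<close>, which is also the limit of
      \<open>R\<close> at 0. So \<open>R\<close> is continuous there, and points with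
      \<open>s n = 0\<close> are covered.\<close>
    define R where "R = (\<lambda>z. (\<psi> z - of_real m * z - of_real v / 2 * z ^ 2) / z ^ 2)"
    have "isCont R 0"
      using taylor_quadratic_remainder[OF \<delta> \<psi>] by (simp add: isCont_def R_def m v)
    then have R_lim: "(\<lambda>n. R (s n)) \<longlonglongrightarrow> 0"
      using isCont_tendsto_compose[OF _ s_lim, of R] by (simp add: R_def)
    \<comment> \<open>Second-order expansion of \<open>\<psi>\<close>: centring leaves only the
      convergent difference \<open>\<mu> n - m * real n\<close> in the linear term, which
      \<open>s n\<close> sends to 0. The quadratic term yields the Gaussian exponent.\<close>
    have split: "of_nat n * \<psi> (s n) - s n * of_real (\<mu> n)
        = s n * of_real (- (\<mu> n - m * real n)) + of_nat n * s n ^ 2 * (of_real v / 2 + R (s n))" for n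
    proof (cases "s n = 0")
      case False
      then have "\<psi> (s n) = of_real m * s n + s n ^ 2 * (of_real v / 2 + R (s n))"
        by (simp add: R_def field_simps)
      then show ?thesis by (simp add: algebra_simps)
    qed (simp add: \<psi>)
    \<comment> \<open>Here \<open>of_nat n * s n ^ 2\<close> is eventually
      \<open>- (t ^ 2) * n / V n\<close>, and \<open>V n\<close> is asymptotic to
      \<open>v * n\<close>.\<close>
    have sq: "(\<lambda>n. of_nat n * s n ^ 2) \<longlonglongrightarrow> of_real (- (t ^ 2) / v)"
    proof -
      have "(\<lambda>n. - (t ^ 2) / v * inverse (V n / (v * real n))) \<longlonglongrightarrow> - (t ^ 2) / v * inverse 1"
        by (intro tendsto_intros Vr) simp
      then have "(\<lambda>n. complex_of_real (- (t ^ 2) / v * inverse (V n / (v * real n)))) \<longlonglongrightarrow> of_real (- (t ^ 2) / v)"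
        by (intro tendsto_of_real) simp
      moreover have "\<forall>\<^sub>F n in sequentially. complex_of_real (- (t ^ 2) / v * inverse (V n / (v * real n))) = of_nat n * s n ^ 2"
        using Vpos
      proof eventually_elim
        case (elim n)
        have "of_nat n * s n ^ 2 = complex_of_real (real n * - ((t / sqrt (V n)) ^ 2))"
          unfolding s_def power_mult_distrib by (simp only: power2_i of_real_mult of_real_minus of_real_power of_real_of_nat_eq) simp
        also have "real n * - ((t / sqrt (V n)) ^ 2) = - (t ^ 2) / v * inverse (V n / (v * real n))"
          using elim v(2) by (simp add: power_divide field_simps)
        finally show ?case by simp
      qed
      ultimately show ?thesis by (rule Lim_transform_eventually)
    qed
    have "(\<lambda>n. of_nat n * \<psi> (s n) - s n * of_real (\<mu> n)) \<longlonglongrightarrow>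
        0 * of_real (- Re (deriv E' 0)) + of_real (- (t ^ 2) / v) * (of_real v / 2 + 0)"
      unfolding split by (intro tendsto_intros s_lim mean sq R_lim)
    also have "0 * of_real (- Re (deriv E' 0)) + of_real (- (t ^ 2) / v) * (of_real v / 2 + 0) = complex_of_real (- (t ^ 2) / 2)"
      using v(2) by simp
    finally have "(\<lambda>n. exp (of_nat n * \<psi> (s n) - s n * of_real (\<mu> n)) * E n (s n)) \<longlonglongrightarrow> exp (complex_of_real (- (t ^ 2) / 2)) * 1"
      by (intro tendsto_intros E_lim)
    then have L: "(\<lambda>n. exp (of_nat n * \<psi> (s n) - s n * of_real (\<mu> n)) * E n (s n)) \<longlonglongrightarrow> char std_normal_distribution t"
      by (simp only: char_std_normal_distribution exp_of_real mult_1_right)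
    show "(\<lambda>n. char (distr (measure_pmf (p n)) borel (\<lambda>a. (X a - \<mu> n) / sqrt (V n))) t) \<longlonglongrightarrow> char std_normal_distribution t"
    proof (rule Lim_transform_eventually[OF L])
      show "\<forall>\<^sub>F n in sequentially. exp (of_nat n * \<psi> (s n) - s n * of_real (\<mu> n)) * E n (s n)
          = char (distr (measure_pmf (p n)) borel (\<lambda>a. (X a - \<mu> n) / sqrt (V n))) t"
        using P s_ball
      proof eventually_elim
        case (elim n)
        have "char (distr (measure_pmf (p n)) borel (\<lambda>a. (X a - \<mu> n) / sqrt (V n))) t
            = measure_pmf.expectation (p n) (\<lambda>a. exp (\<i> * of_real (t * ((X a - \<mu> n) / sqrt (V n)))))"
          unfolding char_def by (subst integral_distr) auto
        also have "\<dots> = measure_pmf.expectation (p n) (\<lambda>a. exp (s n * of_real (X a)) * exp (- s n * of_real (\<mu> n)))"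
        proof (rule Bochner_Integration.integral_cong[OF refl])
          fix a
          have "t * ((X a - \<mu> n) / sqrt (V n)) = t / sqrt (V n) * X a - t / sqrt (V n) * \<mu> n"
            by (simp add: right_diff_distrib diff_divide_distrib)
          then have "\<i> * of_real (t * ((X a - \<mu> n) / sqrt (V n))) = s n * of_real (X a) + - s n * of_real (\<mu> n)"
            unfolding s_def by (simp only: of_real_diff of_real_mult) (simp add: algebra_simps)
          then show "exp (\<i> * of_real (t * ((X a - \<mu> n) / sqrt (V n)))) = exp (s n * of_real (X a)) * exp (- s n * of_real (\<mu> n))"
            by (simp only: exp_add)
        qed
        also have "\<dots> = measure_pmf.expectation (p n) (\<lambda>a. exp (s n * of_real (X a))) * exp (- s n * of_real (\<mu> n))"
          by (rule integral_mult_left_zero)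
        also have "\<dots> = exp (of_nat n * \<psi> (s n)) * E n (s n) * exp (- s n * of_real (\<mu> n))"
          using elim by simp
        also have "\<dots> = exp (of_nat n * \<psi> (s n) - s n * of_real (\<mu> n)) * E n (s n)"
          using exp_add[of "of_nat n * \<psi> (s n)" "- s n * of_real (\<mu> n)"] by (simp add: mult_ac)
        finally show ?case ..
      qed
    qed
  qed
qed

section \<open>The limit law\<close>

lemma deriv_lam: "(lam k has_field_derivative of_real (sqrt (real k)) * exp (s / 2)) (at s)"
  unfolding lam_def by (auto intro!: derivative_eq_intros)

text \<open>The division by \<open>lam k 0\<close> makes the value at 0 vanish, as
  \<open>quasi_power\<close> requires of \<open>\<psi>\<close>; the principal branch is safe on the
  unit disc by \<open>Re_lam_ge_1\<close>.\<close>

definition log_lam :: "nat \<Rightarrow> complex \<Rightarrow> complex" where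
  "log_lam k s = Ln (lam k s / lam k 0)"

lemma deriv_log_lam:
  assumes s: "s \<in> ball 0 1"
  shows "(log_lam k has_field_derivative of_real (sqrt (real k)) * exp (s / 2) / lam k s) (at s)"
proof -
  define l where "l = 1 + 2 * sqrt (real k)"
  have l: "l > 0" "lam k 0 = of_real l" by (auto simp: l_def lam_0 add_pos_nonneg)
  have "Re (lam k s / lam k 0) > 0" using Re_lam_ge_1[OF s, of k] l by (simp add: Re_divide_of_real)
  then have "lam k s / lam k 0 \<notin> \<real>\<^sub>\<le>\<^sub>0" using complex_nonpos_Reals_iff by fastforce
  then have "(log_lam k has_field_derivative inverse (lam k s / lam k 0) * (of_real (sqrt (real k)) * exp (s / 2) / lam k 0)) (at s)"
    unfolding log_lam_def
    by (intro DERIV_chain2[OF has_field_derivative_Ln] DERIV_cdivide deriv_lam)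
  then show ?thesis using l by (simp add: field_simps)
qed

lemma log_lam_derivs:
  shows "log_lam k holomorphic_on ball 0 1" and "log_lam k 0 = 0"
    and "deriv (log_lam k) 0 = of_real (sqrt (real k) / (1 + 2 * sqrt (real k)))"
    and "deriv (deriv (log_lam k)) 0 = of_real (sqrt (real k) / (2 * (1 + 2 * sqrt (real k)) ^ 2))"
proof -
  define r where "r = complex_of_real (sqrt (real k))"
  have l0: "lam k 0 = 1 + 2 * r" by (simp add: lam_def r_def)
  have nz: "1 + 2 * r \<noteq> 0" using lam_nonzero[of 0 k] l0 by simp
  show hol: "log_lam k holomorphic_on ball 0 1"
    using deriv_log_lam holomorphic_on_open[OF open_ball] by blast
  show "log_lam k 0 = 0" using nz by (simp add: log_lam_def l0)
  show "deriv (log_lam k) 0 = of_real (sqrt (real k) / (1 + 2 * sqrt (real k)))"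
    using DERIV_imp_deriv[OF deriv_log_lam[of 0 k]] by (simp add: l0 r_def)
  have "((\<lambda>s. r * exp (s / 2) / lam k s) has_field_derivative (r / 2 * (1 + 2 * r) - r * r) / (1 + 2 * r)\<^sup>2) (at 0)"
    by (rule derivative_eq_intros deriv_lam refl | simp add: l0 nz)+
       (simp add: r_def power2_eq_square)
  then have "(deriv (log_lam k) has_field_derivative (r / 2 * (1 + 2 * r) - r * r) / (1 + 2 * r)\<^sup>2) (at 0)"
    by (rule has_field_derivative_transform_within_open[of _ _ _ "ball 0 1"])
       (use deriv_log_lam in \<open>auto simp: r_def intro!: DERIV_imp_deriv[symmetric]\<close>)
  then have "deriv (deriv (log_lam k)) 0 = (r / 2 * (1 + 2 * r) - r * r) / (1 + 2 * r)\<^sup>2"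
    by (rule DERIV_imp_deriv)
  \<comment> \<open>The numerator collapses to \<open>r / 2\<close>.\<close>
  also have "\<dots> = r / (2 * (1 + 2 * r)\<^sup>2)" using nz by (simp add: field_simps)
  finally show "deriv (deriv (log_lam k)) 0 = of_real (sqrt (real k) / (2 * (1 + 2 * sqrt (real k)) ^ 2))"
    by (simp add: r_def)
qed

lemma expectation_random_term:
  assumes "k \<ge> 1" "n \<ge> 2"
  shows "finite (set_pmf (random_term k n))"
    and "measure_pmf.expectation (random_term k n) (\<lambda>t. exp (s * of_real (real (leaf_count t))))
       = leaf_poly k 0 n s / leaf_poly k 0 n 0"
proof -
  note ne = bounded_closed_terms_nonempty[OF assms] and fin = finite_bounded_closed_terms[of k n]
  show "finite (set_pmf (random_term k n))"
    using ne fin by (simp add: random_term_def)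
  show "measure_pmf.expectation (random_term k n) (\<lambda>t. exp (s * of_real (real (leaf_count t))))
       = leaf_poly k 0 n s / leaf_poly k 0 n 0"
    unfolding random_term_def
    by (subst integral_measure_pmf[OF fin])
       (simp_all add: ne fin, simp add: leaf_poly_def bounded_closed_terms_eq scaleR_conv_of_real sum_divide_distrib)
qed

lemma leaf_poly_eq_level_gf: "s \<in> ball 0 1 \<Longrightarrow> leaf_poly k L n s = lam k s ^ Suc n * level_gf k L s $ Suc n / 2"
  using lam_nonzero[of s k] by (simp add: level_gf_nth)

lemma holomorphic_level_gf_nth: "(\<lambda>s. level_gf k L s $ Suc n) holomorphic_on ball 0 1"
  unfolding level_gf_nth leaf_poly_def lam_def
  by (intro holomorphic_intros) (use lam_nonzero in \<open>auto simp: lam_def\<close>)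

theorem theorem2p1:
  fixes k :: nat
  assumes "k \<ge> 1"
  shows "weak_conv_m
           (\<lambda>n. distr (measure_pmf (random_term k n)) borel (normalized_leaves k n))
           std_normal_distribution
       \<and> (\<lambda>n. mean_leaves k n) \<sim>[at_top]
           (\<lambda>n. real k / (sqrt (real k) + 2 * real k) * real n)
       \<and> (\<lambda>n. var_leaves k n) \<sim>[at_top]
           (\<lambda>n. (real k)\<^sup>2 / (2 * sqrt (real k) * (sqrt (real k) + 2 * real k)\<^sup>2) * real n)"
proof -
  obtain \<delta> \<xi> where \<delta>: "0 < \<delta>" "\<delta> \<le> 1" and t: "tame (ball 0 \<delta>) (level_gf k 0) \<xi>" and pos: "Re (\<xi> 0) > 0"
    using tame_level_gf_0[OF assms] by blast
  let ?B = "ball (0::complex) \<delta>"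
  have B: "?B \<subseteq> ball 0 1" and B0: "0 \<in> ?B" using \<delta> by auto
  have \<xi>0: "\<xi> 0 \<noteq> 0" using pos by auto
  \<comment> \<open>Coefficient \<open>Suc n\<close> of \<open>level_gf\<close> belongs to terms of
    size \<open>n\<close>, hence the weight at \<open>Suc n\<close>.\<close>
  define h where "h n s = of_real (wt (Suc n)) * level_gf k 0 s $ Suc n" for n s
  \<comment> \<open>\<open>leaf_poly k 0 n s\<close> carries the factor
    \<open>lam k s ^ Suc n\<close>. Its \<open>n\<close>-th power goes into
    \<open>exp (of_nat n * log_lam k s)\<close>, so one ratio \<open>lam k s / lam k 0\<close>
    remains here; the weights in \<open>h n s\<close> and \<open>h n 0\<close> cancel.\<close>
  define E where "E n s = lam k s / lam k 0 * h n s * (1 / h n 0)" for n s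
  have l0: "lam k 0 \<noteq> 0" by (simp add: lam_nonzero)
  have h: "uniform_limit ?B h \<xi> sequentially"
    using t filterlim_compose[of "\<lambda>n s. of_real (wt n) * level_gf k 0 s $ n" _ sequentially Suc sequentially]
    unfolding tame_def h_def[abs_def] by (auto intro: filterlim_Suc)
  have h0: "(\<lambda>n. h n 0) \<longlonglongrightarrow> \<xi> 0" by (rule tendsto_uniform_limitI[OF h B0])
  have h0_ev: "\<forall>\<^sub>F n in sequentially. h n 0 \<noteq> 0" by (rule tendsto_imp_eventually_ne[OF h0 \<xi>0])
  obtain K where K: "\<And>s n. s \<in> ?B \<Longrightarrow> wt n * norm (level_gf k 0 s $ n) \<le> K" using tame_bound[OF t] by blast
  have b\<xi>: "bounded (\<xi> ` ?B)" unfolding bounded_iff using tame_limit_bound[OF t K] by blast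
  have "compact (lam k ` cball 0 \<delta>)" by (intro compact_continuous_image continuous_lam compact_cball)
  then have bl: "bounded (lam k ` ?B)" by (rule bounded_subset[OF compact_imp_bounded]) auto
  then obtain Kl where "\<And>s. s \<in> ?B \<Longrightarrow> norm (lam k s) \<le> Kl" unfolding bounded_iff by blast
  then have bl0: "bounded ((\<lambda>s. lam k s / lam k 0) ` ?B)"
    by (auto simp: bounded_iff norm_divide intro!: exI[of _ "Kl / norm (lam k 0)"] divide_right_mono)
  have E_lim: "uniform_limit ?B E (\<lambda>s. lam k s / lam k 0 * \<xi> s * (1 / \<xi> 0)) sequentially"
  proof -
    have c: "uniform_limit ?B (\<lambda>n s. 1 / h n 0) (\<lambda>s. 1 / \<xi> 0) sequentially"
    proof (rule uniform_limitI)
      fix e :: real assume e: "e > 0"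
      have "(\<lambda>n. 1 / h n 0) \<longlonglongrightarrow> 1 / \<xi> 0" by (intro tendsto_intros h0 \<xi>0)
      from tendstoD[OF this e] show "\<forall>\<^sub>F n in sequentially. \<forall>s\<in>?B. dist (1 / h n 0) (1 / \<xi> 0) < e"
        by (rule eventually_mono) blast
    qed
    have lh: "uniform_limit ?B (\<lambda>n s. lam k s / lam k 0 * h n s) (\<lambda>s. lam k s / lam k 0 * \<xi> s) sequentially"
      by (intro uniform_lim_mult uniform_limit_const h bl0 b\<xi>)
    have blh: "bounded ((\<lambda>s. lam k s / lam k 0 * \<xi> s) ` ?B)"
    proof -
      obtain a b where ab: "\<forall>s\<in>?B. norm (lam k s / lam k 0) \<le> a" "\<forall>s\<in>?B. norm (\<xi> s) \<le> b"
        using bl0 b\<xi> by (auto simp: bounded_iff)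
      have "norm (lam k s / lam k 0 * \<xi> s) \<le> a * b" if "s \<in> ?B" for s
        unfolding norm_mult using ab that
        by (intro mult_mono) (auto intro: order_trans[OF norm_ge_zero])
      then show ?thesis unfolding bounded_iff by blast
    qed
    show ?thesis unfolding E_def[abs_def]
      by (rule uniform_lim_mult[OF lh c blh]) (auto simp: bounded_iff)
  qed
  have E_hol: "E n holomorphic_on ?B" for n
  proof -
    have "(\<lambda>s. level_gf k 0 s $ Suc n) holomorphic_on ?B" by (rule holomorphic_on_subset[OF holomorphic_level_gf_nth B])
    moreover have "lam k holomorphic_on ?B"
      using deriv_lam holomorphic_on_open[OF open_ball] by blast
    ultimately show ?thesis unfolding E_def[abs_def] h_def using l0 by (intro holomorphic_intros) auto
  qed
  have fin: "\<forall>\<^sub>F n in sequentially. finite (set_pmf (random_term k n))"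
    using eventually_ge_at_top[of 2] by eventually_elim (rule expectation_random_term(1)[OF assms])
  have P: "\<forall>\<^sub>F n in sequentially. \<forall>s\<in>?B. measure_pmf.expectation (random_term k n) (\<lambda>t. exp (s * of_real (real (leaf_count t))))
      = exp (of_nat n * log_lam k s) * E n s"
    using eventually_ge_at_top[of 2] h0_ev
  proof eventually_elim
    case (elim n)
    show ?case
    proof
      fix s assume s: "s \<in> ?B"
      then have s1: "s \<in> ball 0 1" using B by blast
      have z1: "(0::complex) \<in> ball 0 1" by simp
      have nz: "lam k s \<noteq> 0" by (rule lam_nonzero[OF s1])
      have "exp (of_nat n * log_lam k s) = (lam k s / lam k 0) ^ n"
        using nz l0 by (simp add: exp_of_nat_mult log_lam_def)
      then have "exp (of_nat n * log_lam k s) * E n s = (lam k s ^ Suc n * level_gf k 0 s $ Suc n / 2) / (lam k 0 ^ Suc n * level_gf k 0 0 $ Suc n / 2)"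
        using elim(2) l0 by (simp add: E_def h_def power_divide mult_ac)
      also have "\<dots> = leaf_poly k 0 n s / leaf_poly k 0 n 0"
        by (simp only: leaf_poly_eq_level_gf[OF s1] leaf_poly_eq_level_gf[OF z1])
      finally show "measure_pmf.expectation (random_term k n) (\<lambda>t. exp (s * of_real (real (leaf_count t))))
          = exp (of_nat n * log_lam k s) * E n s"
        using expectation_random_term(2)[OF assms elim(1)] by simp
    qed
  qed
  define r where "r = sqrt (real k)"
  have r: "r > 0" "real k = r ^ 2" using assms by (auto simp: r_def)
  \<comment> \<open>With \<open>k = r^2\<close> a common power of \<open>r\<close> cancels, which
    turns the stated constants into the first two derivatives of \<open>log_lam k\<close> at
    0.\<close>
  have mv: "real k / (r + 2 * real k) = r / (1 + 2 * r)"
    "(real k)\<^sup>2 / (2 * r * (r + 2 * real k)\<^sup>2) = r / (2 * (1 + 2 * r) ^ 2)"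
  proof -
    have e: "r + 2 * r ^ 2 = r * (1 + 2 * r)" by (simp add: power2_eq_square algebra_simps)
    have "1 + 2 * r > 0" using r by simp
    then show "real k / (r + 2 * real k) = r / (1 + 2 * r)"
      "(real k)\<^sup>2 / (2 * r * (r + 2 * real k)\<^sup>2) = r / (2 * (1 + 2 * r) ^ 2)"
      using r(1) unfolding r(2) e by (simp_all add: divide_simps power2_eq_square)
  qed
  note ll = log_lam_derivs[of k, folded r_def]
  have m0: "r / (1 + 2 * r) > 0" and v0: "r / (2 * (1 + 2 * r) ^ 2) > 0" using r(1) by simp_all
  note Q = quasi_power[OF fin \<delta>(1) holomorphic_on_subset[OF ll(1) B] ll(2) always_eventually[OF allI[OF E_hol]] E_lim P ll(3) m0 ll(4) v0]
  show ?thesis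
    using Q unfolding r_def[symmetric] mv mean_leaves_def var_leaves_def normalized_leaves_def[abs_def] by blast
qed

end
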